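(* Let $G=(\mathcal V,\mathcal E)$ be a connected multigraph with $|\mathcal V|\ge2$. Matching rates are policy-invariant for $G$ in each of the following cases: - $G$ is an odd cycle; - $G$ is a tree; - $G$ is a tree with an additional edge forming an odd cycle; - $G$ is a tree with an additional self-loop.
   Context: Multigraphs. A multigraph $G=(\mathcal V,\mathcal E)$ has a finite node set and a symmetric edge set $\mathcal E\subset\mathcal V\times\mathcal V$; self-loops are allowed. A graph is a multigraph without self-loops. For $U\subset\mathcal V$, $\mathcal E(U)=\{v:\exists u\in U,(u,v)\in\mathcal E\}$. $\mathcal M(A)$ (resp. $\overline{\mathcal M}(A)$) is the set of positive measures (resp. probability measures) with full support on the finite set $A$; $\bar\mu=\mu/\mu(\mathcal V)$. General matching model $(G,\Phi,\bar\mu)$ (used when $G$ is not a bipartite graph). Items enter one by one at times $n=1,2,\dots$, with i.i.d. classes $V_n\in\mathcal V$ of law $\bar\mu$. Classes $i,j$ are compatible iff $(i,j)\in\mathcal E$. If the arriving item finds a compatible stored item, it is matched with one of them, chosen by the matching policy $\Phi$, and both leave at once; otherwise it is stored. $\Phi$ is admissible if this choice depends only on the classes and order of arrival of the stored items, on the class of the arriving item, and possibly on a random draw independent of everything else. The state is the word of classes of stored items in order of arrival; the state space $\mathbb W$ is the set of finite words over $\mathcal V$ in which no two letters at distinct positions are compatible. $\textsc{stab}(G,\Phi)$ is the set of $\bar\mu\in\overline{\mathcal M}(\mathcal V)$ for which this Markov chain is positive recurrent. For $(i,j)\in\mathcal E$, let $M_n[i,j]$ be the number of matchings of an $i$-item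 with a $j$-item performed up to time $n$ included; $\Theta^{\Phi,\bar\mu}[i,j]$ is the almost sure limit of $M_n[i,j]/n$ (asymptotic matching rate), which exists when $\bar\mu\in\textsc{stab}(G,\Phi)$. Extended bipartite matching model $(G,\Phi,\tilde\mu)$ (used when $G$ is a bipartite graph, of bipartition $\mathcal V_1\cup\mathcal V_2$). At each time $n$ a couple $V_n=(i,j)\in\mathcal V_1\times\mathcal V_2$ of items enters; couples are i.i.d. of law $\tilde\mu\in\overline{\mathcal M}(\mathcal V_1\times\mathcal V_2)$. First, if there are stored items of classes in $\mathcal V_1$ compatible with the incoming $j$-item, it is matched with one of them, chosen by $\Phi$; then the same procedure is applied to the incoming $i$-item with the stored items of classes in $\mathcal V_2$. If exactly one of the incoming items finds a match in the buffer, the other is stored. If neither does, the two incoming items are matched together if $(i,j)\in\mathcal E$, and otherwise both are stored. Matched items leave at once. Admissibility of $\Phi$ is as in the general model. The state is the pair of words of classes of stored items of each side in order of arrival (two words of the same length such that no letter of the first is compatible with a letter of the second). $\textsc{stab}_{\textsc{b}}(G,\Phi)$ is the set of $\tilde\mu$ for which this Markov chain is positive recurrent. $M^{\textsc b}_n[i,j]$ is the number of matchings of an $i$-item with a $j$-item up to time $n$ included, and $\Theta_{\textsc b}^{\Phi,\tilde\mu}[i,j]$ is the almost sure limit of $M_n^{\textsc b}[i,j]/n$, which exists when $\tilde\mu\in\textsc{stab}_{\textsc b}(G,\Phi)$. For $\mu\in\mathcal M(\mathcal V)$, $\tilde\mu$ denotes a probability measure of $\overline{\mathcal M}(\mathcal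 V_1\times\mathcal V_2)$ with marginals $\tilde\mu_1(i)=\mu(i)/\mu(\mathcal V_1)$, $i\in\mathcal V_1$, and $\tilde\mu_2(j)=\mu(j)/\mu(\mathcal V_2)$, $j\in\mathcal V_2$. Let $\mathcal N(G)=\{\mu\in\mathcal M(\mathcal V):\mu(U)<\mu(\mathcal E(U))\ \forall U\subset\mathcal V,\ U\ne\emptyset,\mathcal V\}$ and, for $G$ bipartite, $\mathcal N_{\textsc b}(G)=\{\mu\in\mathcal M(\mathcal V):\mu(\mathcal V_1)=\mu(\mathcal V_2),\ \mu(U)<\mu(\mathcal E(U))\ \forall U\subset\mathcal V,\ U\ne\emptyset,\mathcal V,\mathcal V_1,\mathcal V_2\}$. Policy-invariance. For a multigraph $G$ that is not a bipartite graph (resp. a bipartite graph $G$), matching rates are policy-invariant for $G$ if for any $\mu\in\mathcal N(G)$ (resp. $\mu\in\mathcal N_{\textsc b}(G)$, with $\tilde\mu$ fixed), the asymptotic matching rates $\Theta^{\Phi,\bar\mu}$ (resp. $\Theta_{\textsc b}^{\Phi,\tilde\mu}$) do not depend on the admissible policy $\Phi$, as long as $\bar\mu\in\textsc{stab}(G,\Phi)$ (resp. $\tilde\mu\in\textsc{stab}_{\textsc b}(G,\Phi)$). *)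

theory Defs
  imports "HOL-Probability.Probability"
begin

section \<open>Multigraphs\<close>

text \<open>
  A multigraph is given by its node set \<open>V\<close> and its symmetric set \<open>E\<close> of ordered pairs, so an
  (undirected) edge between distinct nodes contributes both orientations and a self-loop at \<open>u\<close> is
  the pair \<open>(u, u)\<close>.
\<close>

definition multigraph :: "'a set \<Rightarrow> ('a \<times> 'a) set \<Rightarrow> bool" where
  "multigraph V E \<longleftrightarrow> finite V \<and> E \<subseteq> V \<times> V \<and> sym E"

definition simple_graph :: "'a set \<Rightarrow> ('a \<times> 'a) set \<Rightarrow> bool" where
  "simple_graph V E \<longleftrightarrow> multigraph V E \<and> irrefl E"

definition connected_graph :: "'a set \<Rightarrow> ('a \<times> 'a) set \<Rightarrow> bool" where
  "connected_graph V E \<longleftrightarrow> (\<forall>u\<in>V. \<forall>v\<in>V. (u, v) \<in> E\<^sup>*)"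

definition bipartition ::
    "'a set \<Rightarrow> ('a \<times> 'a) set \<Rightarrow> 'a set \<Rightarrow> 'a set \<Rightarrow> bool" where
  "bipartition V E V1 V2 \<longleftrightarrow> simple_graph V E \<and> V = V1 \<union> V2 \<and> V1 \<inter> V2 = {} \<and>
     E \<subseteq> V1 \<times> V2 \<union> V2 \<times> V1"

definition bipartite :: "'a set \<Rightarrow> ('a \<times> 'a) set \<Rightarrow> bool" where
  "bipartite V E \<longleftrightarrow> (\<exists>V1 V2. bipartition V E V1 V2)"

text \<open>The arcs of the closed walk \<open>xs ! 0, xs ! 1, ..., xs ! (length xs - 1), xs ! 0\<close>.\<close>

definition cycle_arcs :: "'a list \<Rightarrow> ('a \<times> 'a) set" where
  "cycle_arcs xs = {(xs ! k, xs ! (Suc k mod length xs)) | k. k < length xs}"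

definition cycle_in :: "('a \<times> 'a) set \<Rightarrow> 'a list \<Rightarrow> bool" where
  "cycle_in E xs \<longleftrightarrow> 3 \<le> length xs \<and> distinct xs \<and> cycle_arcs xs \<subseteq> E"

definition odd_cycle_graph :: "'a set \<Rightarrow> ('a \<times> 'a) set \<Rightarrow> bool" where
  "odd_cycle_graph V E \<longleftrightarrow> (\<exists>xs. 3 \<le> length xs \<and> distinct xs \<and> odd (length xs) \<and>
     V = set xs \<and> E = cycle_arcs xs \<union> (cycle_arcs xs)\<inverse>)"

definition tree_graph :: "'a set \<Rightarrow> ('a \<times> 'a) set \<Rightarrow> bool" where
  "tree_graph V E \<longleftrightarrow> simple_graph V E \<and> connected_graph V E \<and> (\<nexists>xs. cycle_in E xs)"

definition tree_plus_odd_edge :: "'a set \<Rightarrow> ('a \<times> 'a) set \<Rightarrow> bool" where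
  "tree_plus_odd_edge V E \<longleftrightarrow> (\<exists>T u v. tree_graph V T \<and> u \<in> V \<and> v \<in> V \<and> u \<noteq> v \<and>
     (u, v) \<notin> T \<and> E = T \<union> {(u, v), (v, u)} \<and>
     (\<exists>xs. cycle_in E xs \<and> odd (length xs) \<and> (u, v) \<in> cycle_arcs xs))"

definition tree_plus_self_loop :: "'a set \<Rightarrow> ('a \<times> 'a) set \<Rightarrow> bool" where
  "tree_plus_self_loop V E \<longleftrightarrow> (\<exists>T u. tree_graph V T \<and> u \<in> V \<and> E = T \<union> {(u, u)})"


section \<open>Measures on finite sets\<close>

text \<open>
  A measure on a finite set \<open>A\<close> is represented by its weight function, of which only the values
  on \<open>A\<close> matter; the measure of \<open>U \<subseteq> A\<close> is \<open>sum \<mu> U\<close>.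
\<close>

definition full_measures :: "'a set \<Rightarrow> ('a \<Rightarrow> real) set" where
  "full_measures A = {\<mu>. \<forall>a\<in>A. 0 < \<mu> a}"

definition full_prob_measures :: "'a set \<Rightarrow> ('a \<Rightarrow> real) set" where
  "full_prob_measures A = {\<mu> \<in> full_measures A. sum \<mu> A = 1}"

definition normalize_measure :: "'a set \<Rightarrow> ('a \<Rightarrow> real) \<Rightarrow> 'a \<Rightarrow> real" where
  "normalize_measure V \<mu> v = \<mu> v / sum \<mu> V"

definition ncond :: "'a set \<Rightarrow> ('a \<times> 'a) set \<Rightarrow> ('a \<Rightarrow> real) set" where
  "ncond V E = {\<mu> \<in> full_measures V.
     \<forall>U. U \<subseteq> V \<longrightarrow> U \<noteq> {} \<longrightarrow> U \<noteq> V \<longrightarrow> sum \<mu> U < sum \<mu> (E `` U)}"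

definition ncond_bip :: "'a set \<Rightarrow> 'a set \<Rightarrow> ('a \<times> 'a) set \<Rightarrow> ('a \<Rightarrow> real) set" where
  "ncond_bip V1 V2 E = {\<mu> \<in> full_measures (V1 \<union> V2). sum \<mu> V1 = sum \<mu> V2 \<and>
     (\<forall>U. U \<subseteq> V1 \<union> V2 \<longrightarrow> U \<noteq> {} \<longrightarrow> U \<noteq> V1 \<union> V2 \<longrightarrow> U \<noteq> V1 \<longrightarrow> U \<noteq> V2 \<longrightarrow>
        sum \<mu> U < sum \<mu> (E `` U))}"

definition couplings :: "'a set \<Rightarrow> 'a set \<Rightarrow> ('a \<Rightarrow> real) \<Rightarrow> ('a \<times> 'a \<Rightarrow> real) set" where
  "couplings V1 V2 \<mu> = {\<nu> \<in> full_prob_measures (V1 \<times> V2).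
     (\<forall>i\<in>V1. (\<Sum>j\<in>V2. \<nu> (i, j)) = \<mu> i / sum \<mu> V1) \<and>
     (\<forall>j\<in>V2. (\<Sum>i\<in>V1. \<nu> (i, j)) = \<mu> j / sum \<mu> V2)}"


section \<open>Matching chains driven by i.i.d. inputs\<close>

text \<open>
  A matching chain is a random recursion: \<open>f s x\<close> is the pair of the state following \<open>s\<close> when the
  input is \<open>x\<close> and of the list of matchings (pairs of classes) performed in this step. The input at
  time \<open>n + 1\<close> is \<open>\<omega> !! n\<close>; under \<open>stream_space D\<close> the inputs are i.i.d. of law \<open>D\<close>, so the
  trajectory is a Markov chain.
\<close>

primrec trajectory ::
    "('s \<Rightarrow> 'x \<Rightarrow> 's \<times> ('a \<times> 'a) list) \<Rightarrow> 's \<Rightarrow> 'x stream \<Rightarrow> nat \<Rightarrow> 's" where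
  "trajectory f s \<omega> 0 = s"
| "trajectory f s \<omega> (Suc n) = fst (f (trajectory f s \<omega> n) (\<omega> !! n))"

text \<open>
  The number of matchings of an \<open>i\<close>-item with a \<open>j\<close>-item up to time \<open>n\<close> included; matchings are
  unordered, so either orientation of the recorded pair counts (once).
\<close>

definition num_matchings ::
    "('s \<Rightarrow> 'x \<Rightarrow> 's \<times> ('a \<times> 'a) list) \<Rightarrow> 's \<Rightarrow> 'x stream \<Rightarrow> 'a \<Rightarrow> 'a \<Rightarrow> nat \<Rightarrow> nat" where
  "num_matchings f s \<omega> i j n =
     (\<Sum>k<n. length (filter (\<lambda>p. p = (i, j) \<or> p = (j, i))
                     (snd (f (trajectory f s \<omega> k) (\<omega> !! k)))))"

text \<open>The infimum is \<open>\<infinity>\<close> if the chain never returns to its initial state.\<close>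

definition return_time ::
    "('s \<Rightarrow> 'x \<Rightarrow> 's \<times> ('a \<times> 'a) list) \<Rightarrow> 's \<Rightarrow> 'x stream \<Rightarrow> ennreal" where
  "return_time f s \<omega> = (INF n \<in> {n. 1 \<le> n \<and> trajectory f s \<omega> n = s}. of_nat n)"

definition positive_recurrent ::
    "'x measure \<Rightarrow> ('s \<Rightarrow> 'x \<Rightarrow> 's \<times> ('a \<times> 'a) list) \<Rightarrow> 's set \<Rightarrow> bool" where
  "positive_recurrent D f S \<longleftrightarrow>
     (\<forall>s\<in>S. (\<integral>\<^sup>+ \<omega>. return_time f s \<omega> \<partial>stream_space D) < \<infinity>)"

text \<open>\<open>\<theta>\<close> is the almost sure limit of the rate of \<open>i\<close>-\<open>j\<close> matchings, whatever the initial state.\<close>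

definition has_matching_rate ::
    "'x measure \<Rightarrow> ('s \<Rightarrow> 'x \<Rightarrow> 's \<times> ('a \<times> 'a) list) \<Rightarrow> 's set \<Rightarrow> 'a \<Rightarrow> 'a \<Rightarrow> real \<Rightarrow> bool"
  where
  "has_matching_rate D f S i j \<theta> \<longleftrightarrow>
     (\<forall>s\<in>S. AE \<omega> in stream_space D.
        (\<lambda>n. real (num_matchings f s \<omega> i j n) / real n) \<longlonglongrightarrow> \<theta>)"

definition compatible_positions :: "('a \<times> 'a) set \<Rightarrow> 'a list \<Rightarrow> 'a \<Rightarrow> nat set" where
  "compatible_positions E w v = {k. k < length w \<and> (w ! k, v) \<in> E}"

definition remove_nth :: "nat \<Rightarrow> 'a list \<Rightarrow> 'a list" where
  "remove_nth k w = take k w @ drop (Suc k) w"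

text \<open>
  The random draws available to the policies: independent uniform variables on the unit interval,
  from which any random choice among finitely many stored items can be made.
\<close>

definition uniform_draw :: "real measure" where
  "uniform_draw = uniform_measure lborel {0..1}"


section \<open>The general matching model\<close>

text \<open>
  States are words of classes, oldest item first. A policy maps the stored word, the class of the
  arriving item and a random draw to the position of the stored item to be matched.
\<close>

type_synonym 'a policy = "'a list \<Rightarrow> 'a \<Rightarrow> real \<Rightarrow> nat"

definition words :: "'a set \<Rightarrow> ('a \<times> 'a) set \<Rightarrow> 'a list set" where
  "words V E = {w \<in> lists V.
     \<forall>p<length w. \<forall>q<length w. p \<noteq> q \<longrightarrow> (w ! p, w ! q) \<notin> E}"

definition admissible :: "'a set \<Rightarrow> ('a \<times> 'a) set \<Rightarrow> 'a policy \<Rightarrow> bool" where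
  "admissible V E \<Phi> \<longleftrightarrow> (\<forall>w \<in> words V E. \<forall>v\<in>V.
     \<Phi> w v \<in> borel \<rightarrow>\<^sub>M count_space UNIV \<and>
     (compatible_positions E w v \<noteq> {} \<longrightarrow> (\<forall>r. \<Phi> w v r \<in> compatible_positions E w v)))"

fun step ::
    "('a \<times> 'a) set \<Rightarrow> 'a policy \<Rightarrow> 'a list \<Rightarrow> 'a \<times> real \<Rightarrow> 'a list \<times> ('a \<times> 'a) list" where
  "step E \<Phi> w (v, r) =
     (if compatible_positions E w v = {} then (w @ [v], [])
      else (let k = \<Phi> w v r in (remove_nth k w, [(w ! k, v)])))"

definition input_law :: "'a set \<Rightarrow> ('a \<Rightarrow> real) \<Rightarrow> ('a \<times> real) measure" where
  "input_law V \<nu> = point_measure V (\<lambda>v. ennreal (\<nu> v)) \<Otimes>\<^sub>M uniform_draw"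

definition stab :: "'a set \<Rightarrow> ('a \<times> 'a) set \<Rightarrow> 'a policy \<Rightarrow> ('a \<Rightarrow> real) set" where
  "stab V E \<Phi> = {\<nu> \<in> full_prob_measures V.
     positive_recurrent (input_law V \<nu>) (step E \<Phi>) (words V E)}"

definition asymptotic_matching_rate ::
    "'a set \<Rightarrow> ('a \<times> 'a) set \<Rightarrow> 'a policy \<Rightarrow> ('a \<Rightarrow> real) \<Rightarrow> 'a \<Rightarrow> 'a \<Rightarrow> real \<Rightarrow> bool" where
  "asymptotic_matching_rate V E \<Phi> \<nu> i j \<theta> \<longleftrightarrow>
     has_matching_rate (input_law V \<nu>) (step E \<Phi>) (words V E) i j \<theta>"


section \<open>The extended bipartite matching model\<close>

text \<open>
  States are pairs of words, one per side. As the two sides are disjoint, one function serves for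
  both: given the class of the arriving item, it returns a position in the word of the other side.
  Its first argument is the buffer content at the moment of the choice. When the \<open>V1\<close>-item of a
  couple makes its choice, the partner of the \<open>V2\<close>-item (if any) has already left, so the two words
  may have different lengths; admissibility is therefore required on all pairs of words over the two
  sides (its values on pairs that never occur are irrelevant).
\<close>

type_synonym 'a bip_policy = "'a list \<times> 'a list \<Rightarrow> 'a \<Rightarrow> real \<Rightarrow> nat"

definition bip_words :: "'a set \<Rightarrow> 'a set \<Rightarrow> ('a \<times> 'a) set \<Rightarrow> ('a list \<times> 'a list) set" where
  "bip_words V1 V2 E = {(x, y). x \<in> lists V1 \<and> y \<in> lists V2 \<and> length x = length y \<and>
     (\<forall>a \<in> set x. \<forall>b \<in> set y. (a, b) \<notin> E)}"

definition bip_admissible ::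
    "'a set \<Rightarrow> 'a set \<Rightarrow> ('a \<times> 'a) set \<Rightarrow> 'a bip_policy \<Rightarrow> bool" where
  "bip_admissible V1 V2 E \<Phi> \<longleftrightarrow> (\<forall>x \<in> lists V1. \<forall>y \<in> lists V2.
     (\<forall>v \<in> V1 \<union> V2. \<Phi> (x, y) v \<in> borel \<rightarrow>\<^sub>M count_space UNIV) \<and>
     (\<forall>j\<in>V2. compatible_positions E x j \<noteq> {} \<longrightarrow>
        (\<forall>r. \<Phi> (x, y) j r \<in> compatible_positions E x j)) \<and>
     (\<forall>i\<in>V1. compatible_positions E y i \<noteq> {} \<longrightarrow>
        (\<forall>r. \<Phi> (x, y) i r \<in> compatible_positions E y i)))"

fun bip_step ::
    "('a \<times> 'a) set \<Rightarrow> 'a bip_policy \<Rightarrow> 'a list \<times> 'a list \<Rightarrow> ('a \<times> 'a) \<times> (real \<times> real) \<Rightarrow>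
     ('a list \<times> 'a list) \<times> ('a \<times> 'a) list" where
  "bip_step E \<Phi> (x, y) ((i, j), (r, s)) =
     (let j_matched = (compatible_positions E x j \<noteq> {});
          i_matched = (compatible_positions E y i \<noteq> {});
          k = \<Phi> (x, y) j r;
          x' = (if j_matched then remove_nth k x else x);
          l = \<Phi> (x', y) i s;
          y' = (if i_matched then remove_nth l y else y)
      in if \<not> j_matched \<and> \<not> i_matched
         then (if (i, j) \<in> E then ((x, y), [(i, j)]) else ((x @ [i], y @ [j]), []))
         else ((if i_matched then x' else x' @ [i], if j_matched then y' else y' @ [j]),
               (if j_matched then [(x ! k, j)] else []) @
               (if i_matched then [(i, y ! l)] else [])))"

definition bip_input_law ::
    "'a set \<Rightarrow> 'a set \<Rightarrow> ('a \<times> 'a \<Rightarrow> real) \<Rightarrow> (('a \<times> 'a) \<times> (real \<times> real)) measure" where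
  "bip_input_law V1 V2 \<nu> =
     point_measure (V1 \<times> V2) (\<lambda>p. ennreal (\<nu> p)) \<Otimes>\<^sub>M (uniform_draw \<Otimes>\<^sub>M uniform_draw)"

definition bip_stab ::
    "'a set \<Rightarrow> 'a set \<Rightarrow> ('a \<times> 'a) set \<Rightarrow> 'a bip_policy \<Rightarrow> ('a \<times> 'a \<Rightarrow> real) set" where
  "bip_stab V1 V2 E \<Phi> = {\<nu> \<in> full_prob_measures (V1 \<times> V2).
     positive_recurrent (bip_input_law V1 V2 \<nu>) (bip_step E \<Phi>) (bip_words V1 V2 E)}"

definition bip_asymptotic_matching_rate ::
    "'a set \<Rightarrow> 'a set \<Rightarrow> ('a \<times> 'a) set \<Rightarrow> 'a bip_policy \<Rightarrow> ('a \<times> 'a \<Rightarrow> real) \<Rightarrow>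
     'a \<Rightarrow> 'a \<Rightarrow> real \<Rightarrow> bool" where
  "bip_asymptotic_matching_rate V1 V2 E \<Phi> \<nu> i j \<theta> \<longleftrightarrow>
     has_matching_rate (bip_input_law V1 V2 \<nu>) (bip_step E \<Phi>) (bip_words V1 V2 E) i j \<theta>"


section \<open>Policy-invariance\<close>

text \<open>
  Independence of the policy is expressed by one family \<open>\<theta>\<close> of rates valid for all policies under
  which the model is stable; existence of the almost sure limits is thus part of the claim.
\<close>

definition gen_policy_invariant :: "'a set \<Rightarrow> ('a \<times> 'a) set \<Rightarrow> bool" where
  "gen_policy_invariant V E \<longleftrightarrow> (\<forall>\<mu> \<in> ncond V E. \<exists>\<theta>. \<forall>\<Phi>.
     admissible V E \<Phi> \<longrightarrow> normalize_measure V \<mu> \<in> stab V E \<Phi> \<longrightarrow>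
     (\<forall>(i, j) \<in> E. asymptotic_matching_rate V E \<Phi> (normalize_measure V \<mu>) i j (\<theta> i j)))"

definition bip_policy_invariant :: "'a set \<Rightarrow> 'a set \<Rightarrow> ('a \<times> 'a) set \<Rightarrow> bool" where
  "bip_policy_invariant V1 V2 E \<longleftrightarrow>
     (\<forall>\<mu> \<in> ncond_bip V1 V2 E. \<forall>\<nu> \<in> couplings V1 V2 \<mu>. \<exists>\<theta>. \<forall>\<Phi>.
        bip_admissible V1 V2 E \<Phi> \<longrightarrow> \<nu> \<in> bip_stab V1 V2 E \<Phi> \<longrightarrow>
        (\<forall>(i, j) \<in> E. bip_asymptotic_matching_rate V1 V2 E \<Phi> \<nu> i j (\<theta> i j)))"

definition policy_invariant :: "'a set \<Rightarrow> ('a \<times> 'a) set \<Rightarrow> bool" where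
  "policy_invariant V E \<longleftrightarrow>
     (if bipartite V E
      then (\<forall>V1 V2. bipartition V E V1 V2 \<longrightarrow> bip_policy_invariant V1 V2 E)
      else gen_policy_invariant V E)"

end

theory Submission
  imports Defs "HOL-Library.Transitive_Closure_Table"
begin

text \<open>
  Matching rates are policy-invariant because on these multigraphs the number of matchings along an edge
  can be read off from the arrivals and the stored items alone. Call a real function \<open>\<sigma>\<close> on the nodes
  isolating for the edge between \<open>u\<close> and \<open>v\<close> if \<open>\<sigma> x + \<sigma> y\<close> is \<open>1\<close> on that edge and \<open>0\<close> on all other
  edges (a self-loop at \<open>x\<close> contributes \<open>2 * \<sigma> x\<close>). Give each item the weight \<open>\<sigma>\<close> of its class. Matched
  items take away weight \<open>1\<close> per matching between \<open>u\<close> and \<open>v\<close> and weight \<open>0\<close> per other matching. Hence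
  the number of matchings between \<open>u\<close> and \<open>v\<close> is the weight that has arrived minus the growth of the
  weight in the buffer, whatever the policy.

  Divided by time, the weight of the arrivals converges to its mean by the law of large numbers, and the
  weight of the buffer vanishes under positive recurrence: the chain has short excursions from its
  initial state, by a Borel--Cantelli argument on the tails of the return time, and the buffer grows
  by a bounded amount per step (\<open>random_recursion.AE_sublinear\<close>). The rate is thus the mean of \<open>\<sigma>\<close>
  under the input law (\<open>random_recursion.matching_rate_of_balance\<close>). The argument is the same for the
  general and for the extended bipartite model.

  It remains to find isolating functions. In a forest every edge is a bridge, and a two-colouring with
  values \<open>1\<close> and \<open>-1\<close>, restricted to one side of the bridge, isolates it
  (\<open>forest_isolable_two_coloring\<close>). An additional edge between two nodes of the same colour, as is the
  case for a self-loop and for an edge closing an odd cycle, is isolated by the two-colouring itself up to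
  a factor, and can then be eliminated from the functions isolating the other edges
  (\<open>edges_isolable_insert_monochromatic\<close>). On an odd cycle the alternating function does it
  (\<open>odd_cycle_isolable\<close>).
\<close>

section \<open>Edge-isolating functions on nodes\<close>

text \<open>
  Summed over all matchings performed so far, \<open>\<sigma> x + \<sigma> y\<close> counts the matchings along the single
  edge between \<open>u\<close> and \<open>v\<close>. In matrix terms, \<open>\<sigma>\<close> is a row of a left inverse of the incidence
  matrix of the multigraph, a self-loop contributing the entry \<open>2\<close>.
\<close>

definition isolates :: "('a \<times> 'a) set \<Rightarrow> ('a \<Rightarrow> real) \<Rightarrow> 'a \<Rightarrow> 'a \<Rightarrow> bool" where
  "isolates E \<sigma> u v \<longleftrightarrow> (\<forall>x y. (x, y) \<in> E \<longrightarrow>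
     \<sigma> x + \<sigma> y = of_bool ((x, y) = (u, v) \<or> (x, y) = (v, u)))"

definition edges_isolable :: "('a \<times> 'a) set \<Rightarrow> bool" where
  "edges_isolable E \<longleftrightarrow> (\<forall>u v. (u, v) \<in> E \<longrightarrow> (\<exists>\<sigma>. isolates E \<sigma> u v))"

text \<open>
  The colours are \<open>1\<close> and \<open>-1\<close>, so that a two-colouring is at once a function whose sum over the two
  ends of every edge vanishes. It lives on the whole type, which spares any mention of the node set.
\<close>

definition two_coloring :: "('a \<times> 'a) set \<Rightarrow> ('a \<Rightarrow> real) \<Rightarrow> bool" where
  "two_coloring E \<kappa> \<longleftrightarrow> (\<forall>x. \<bar>\<kappa> x\<bar> = 1) \<and> (\<forall>x y. (x, y) \<in> E \<longrightarrow> \<kappa> y = - \<kappa> x)"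

lemma isolatesI:
  "(\<And>x y. (x, y) \<in> E \<Longrightarrow> \<sigma> x + \<sigma> y = of_bool ((x, y) = (u, v) \<or> (x, y) = (v, u))) \<Longrightarrow>
    isolates E \<sigma> u v"
  unfolding isolates_def by blast

lemma isolatesD:
  "isolates E \<sigma> u v \<Longrightarrow> (x, y) \<in> E \<Longrightarrow>
    \<sigma> x + \<sigma> y = of_bool ((x, y) = (u, v) \<or> (x, y) = (v, u))"
  unfolding isolates_def by blast

lemma isolates_swap: "isolates E \<sigma> u v \<Longrightarrow> isolates E \<sigma> v u"
  unfolding isolates_def by (simp only: disj_commute)

lemma two_coloringD: "two_coloring E \<kappa> \<Longrightarrow> (x, y) \<in> E \<Longrightarrow> \<kappa> y = - \<kappa> x"
  unfolding two_coloring_def by blast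

lemma two_coloring_abs: "two_coloring E \<kappa> \<Longrightarrow> \<bar>\<kappa> x\<bar> = 1"
  unfolding two_coloring_def by blast

lemma two_coloring_nonzero: "two_coloring E \<kappa> \<Longrightarrow> \<kappa> x \<noteq> 0"
  using two_coloring_abs[of E \<kappa> x] by auto

text \<open>
  This is a step of Gaussian elimination: a function isolating an old edge may fail on the new edge,
  and subtracting the right multiple of \<open>\<sigma>\<close> repairs this without disturbing the old edges.
\<close>

lemma edges_isolable_insert:
  assumes F: "edges_isolable F" and \<sigma>: "isolates (F \<union> {(a, b), (b, a)}) \<sigma> a b"
  shows "edges_isolable (F \<union> {(a, b), (b, a)})"
  unfolding edges_isolable_def
proof (intro allI impI)
  fix u v assume uv: "(u, v) \<in> F \<union> {(a, b), (b, a)}"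
  show "\<exists>\<tau>. isolates (F \<union> {(a, b), (b, a)}) \<tau> u v"
  proof (cases "(u, v) = (a, b) \<or> (u, v) = (b, a)")
    case True
    then show ?thesis using \<sigma> isolates_swap[OF \<sigma>] by (elim disjE) blast+
  next
    case False
    with uv F obtain \<tau> where \<tau>: "isolates F \<tau> u v"
      by (auto simp: edges_isolable_def)
    have "isolates (F \<union> {(a, b), (b, a)}) (\<lambda>x. \<tau> x - (\<tau> a + \<tau> b) * \<sigma> x) u v"
    proof (rule isolatesI)
      fix x y assume xy: "(x, y) \<in> F \<union> {(a, b), (b, a)}"
      have "\<tau> x - (\<tau> a + \<tau> b) * \<sigma> x + (\<tau> y - (\<tau> a + \<tau> b) * \<sigma> y)
          = (\<tau> x + \<tau> y) - (\<tau> a + \<tau> b) * (\<sigma> x + \<sigma> y)"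
        by (simp add: algebra_simps)
      also have "\<dots> = of_bool ((x, y) = (u, v) \<or> (x, y) = (v, u))"
      proof (cases "(x, y) = (a, b) \<or> (x, y) = (b, a)")
        case True
        then have "\<sigma> x + \<sigma> y = 1" using isolatesD[OF \<sigma> xy] by simp
        moreover have "\<tau> x + \<tau> y = \<tau> a + \<tau> b" using True by (elim disjE) simp_all
        moreover have "\<not> ((x, y) = (u, v) \<or> (x, y) = (v, u))"
          using True False by (elim disjE) auto
        ultimately show ?thesis by simp
      next
        case xy': False
        then have "(x, y) \<in> F" using xy by blast
        moreover have "\<sigma> x + \<sigma> y = 0" using isolatesD[OF \<sigma> xy] xy' by simp
        ultimately show ?thesis using isolatesD[OF \<tau>] by simp
      qed
      finally show "\<tau> x - (\<tau> a + \<tau> b) * \<sigma> x + (\<tau> y - (\<tau> a + \<tau> b) * \<sigma> y)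
          = of_bool ((x, y) = (u, v) \<or> (x, y) = (v, u))" .
    qed
    then show ?thesis by blast
  qed
qed

text \<open>
  A path from \<open>u\<close> to \<open>v\<close> without repetitions is closed by the arc from \<open>v\<close> back to \<open>u\<close>; it has at
  least three nodes because it cannot be the single arc from \<open>u\<close> to \<open>v\<close>. Hence each edge of a
  forest is a bridge.
\<close>

lemma detour_gives_cycle:
  assumes "(u, v) \<in> R\<^sup>*" "u \<noteq> v" "(u, v) \<notin> R"
  shows "\<exists>xs. cycle_in (insert (v, u) R) xs"
proof -
  have "(\<lambda>x y. (x, y) \<in> R)\<^sup>*\<^sup>* u v"
    using assms(1) by (simp add: rtrancl_def)
  then obtain zs where "rtrancl_path (\<lambda>x y. (x, y) \<in> R) u zs v"
    by (auto simp: rtranclp_eq_rtrancl_path)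
  then obtain xs where xs: "rtrancl_path (\<lambda>x y. (x, y) \<in> R) u xs v" "distinct (u # xs)"
    by (rule rtrancl_path_distinct)
  have "xs \<noteq> []"
    using xs(1) assms(2) by (auto elim: rtrancl_path.cases)
  with xs have lst: "last xs = v" by (auto dest: rtrancl_path_last)
  have arc: "((u # xs) ! k, xs ! k) \<in> R" if "k < length xs" for k
    using rtrancl_path_nth[OF xs(1) that] .
  have "length xs \<noteq> 1"
    using arc[of 0] lst assms(3) by (auto simp: length_Suc_conv)
  with \<open>xs \<noteq> []\<close> have len: "2 \<le> length xs"
    by (cases xs) (auto simp: Suc_le_eq)
  have "cycle_arcs (u # xs) \<subseteq> insert (v, u) R"
  proof
    fix e assume "e \<in> cycle_arcs (u # xs)"
    then obtain k where k: "k < Suc (length xs)"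
        "e = ((u # xs) ! k, (u # xs) ! (Suc k mod Suc (length xs)))"
      by (auto simp: cycle_arcs_def)
    show "e \<in> insert (v, u) R"
    proof (cases "k = length xs")
      case True
      then show ?thesis using k lst \<open>xs \<noteq> []\<close> by (simp add: last_conv_nth nth_Cons')
    next
      case False
      then show ?thesis using k arc[of k] by simp
    qed
  qed
  then have "cycle_in (insert (v, u) R) (u # xs)"
    using xs(2) len by (simp add: cycle_in_def)
  then show ?thesis ..
qed

lemma cycle_in_mono: "cycle_in E xs \<Longrightarrow> E \<subseteq> F \<Longrightarrow> cycle_in F xs"
  by (auto simp: cycle_in_def)

text \<open>
  The two claims are proved together by removing one edge, a bridge between \<open>u\<close> and \<open>v\<close>. The
  two-colouring of the rest, restricted to the component of \<open>u\<close>, isolates the removed edge, and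
  swapping the colours of that component if necessary makes it a two-colouring of the whole forest.
\<close>

lemma forest_isolable_two_coloring:
  assumes "finite F" "sym F" "irrefl F" "\<nexists>xs. cycle_in F xs"
  shows "edges_isolable F \<and> (\<exists>\<kappa>. two_coloring F \<kappa>)"
  using assms
proof (induction F rule: finite_psubset_induct)
  case (psubset F)
  show ?case
  proof (cases "F = {}")
    case True
    then show ?thesis
      by (auto simp: edges_isolable_def two_coloring_def intro!: exI[of _ "\<lambda>_. 1"])
  next
    case False
    then obtain u v where uv: "(u, v) \<in> F" by auto
    with psubset.prems have vu: "(v, u) \<in> F" and "u \<noteq> v"
      by (auto dest: symD irreflD)
    define R where "R = F - {(u, v), (v, u)}"
    have F: "F = R \<union> {(u, v), (v, u)}" using uv vu by (auto simp: R_def)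
    have symR: "sym R" using psubset.prems(1) by (auto simp: R_def sym_def)
    have "irrefl R" using psubset.prems(2) by (auto simp: R_def irrefl_def)
    moreover have "\<nexists>xs. cycle_in R xs"
      using psubset.prems(3) cycle_in_mono[of R _ F] by (auto simp: R_def)
    moreover have "R \<subset> F" using uv by (auto simp: R_def)
    ultimately obtain \<kappa> where iso: "edges_isolable R" and \<kappa>: "two_coloring R \<kappa>"
      using psubset.IH symR by blast
    define C where "C = {x. (u, x) \<in> R\<^sup>*}"
    have "u \<in> C" by (simp add: C_def)
    have "v \<notin> C"
    proof
      assume "v \<in> C"
      then have "\<exists>xs. cycle_in (insert (v, u) R) xs"
        using detour_gives_cycle[of u v R] \<open>u \<noteq> v\<close> by (auto simp: C_def R_def)
      then show False
        using psubset.prems(3) cycle_in_mono[of "insert (v, u) R" _ F] by (auto simp: F)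
    qed
    have C: "x \<in> C \<longleftrightarrow> y \<in> C" if "(x, y) \<in> R" for x y
      using that symR by (auto simp: C_def dest: symD intro: rtrancl.rtrancl_into_rtrancl)
    have abs: "\<bar>\<kappa> x\<bar> = 1" and alt: "(x, y) \<in> R \<Longrightarrow> \<kappa> y = - \<kappa> x" for x y
      using two_coloring_abs[OF \<kappa>] two_coloringD[OF \<kappa>] by blast+
    have "\<kappa> u \<noteq> 0" using two_coloring_nonzero[OF \<kappa>] .
    \<comment> \<open>On the edges of \<open>R\<close> both ends lie in \<open>C\<close> or neither does; only the bridge leaves \<open>C\<close>.\<close>
    have "isolates F (\<lambda>x. if x \<in> C then \<kappa> x / \<kappa> u else 0) u v"
    proof (rule isolatesI)
      fix x y assume "(x, y) \<in> F"
      then consider "(x, y) = (u, v)" | "(x, y) = (v, u)"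
        | "(x, y) \<in> R" "(x, y) \<noteq> (u, v)" "(x, y) \<noteq> (v, u)"
        by (auto simp: R_def)
      then show "(if x \<in> C then \<kappa> x / \<kappa> u else 0) + (if y \<in> C then \<kappa> y / \<kappa> u else 0)
          = of_bool ((x, y) = (u, v) \<or> (x, y) = (v, u))"
      proof cases
        case 3
        then show ?thesis using C[of x y] alt[of x y] by simp
      qed (use \<open>u \<in> C\<close> \<open>v \<notin> C\<close> \<open>\<kappa> u \<noteq> 0\<close> \<open>u \<noteq> v\<close> in simp_all)
    qed
    with iso have "edges_isolable F"
      unfolding F by (rule edges_isolable_insert)
    \<comment> \<open>The factor \<open>- \<kappa> u * \<kappa> v\<close> is \<open>-1\<close> exactly if \<open>u\<close> and \<open>v\<close> have the same colour.\<close>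
    moreover have "two_coloring F (\<lambda>x. if x \<in> C then - \<kappa> u * \<kappa> v * \<kappa> x else \<kappa> x)"
    proof -
      have "\<kappa> u * \<kappa> u = 1" using abs[of u] by (metis abs_mult_self_eq mult_1)
      then have \<kappa>u: "\<kappa> u * \<kappa> v * \<kappa> u = \<kappa> v" by (simp add: ac_simps)
      have "(if y \<in> C then - \<kappa> u * \<kappa> v * \<kappa> y else \<kappa> y)
          = - (if x \<in> C then - \<kappa> u * \<kappa> v * \<kappa> x else \<kappa> x)" if "(x, y) \<in> F" for x y
      proof -
        from that consider "(x, y) = (u, v)" | "(x, y) = (v, u)" | "(x, y) \<in> R"
          by (auto simp: R_def)
        then show ?thesis
        proof cases
          case 3
          then show ?thesis using C[of x y] alt[of x y] by simp
        qed (use \<open>u \<in> C\<close> \<open>v \<notin> C\<close> \<kappa>u in simp_all)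
      qed
      then show ?thesis by (auto simp: two_coloring_def abs_mult abs)
    qed
    ultimately show ?thesis by blast
  qed
qed

lemma cycle_arcs_rotate: "cycle_arcs (rotate n xs) = cycle_arcs xs"
proof -
  have sub: "cycle_arcs (rotate n xs) \<subseteq> cycle_arcs xs" for n and xs :: "'b list"
  proof
    fix e assume "e \<in> cycle_arcs (rotate n xs)"
    then obtain k where k: "k < length xs"
        "e = (rotate n xs ! k, rotate n xs ! (Suc k mod length xs))"
      by (auto simp: cycle_arcs_def)
    moreover have "0 < length xs" using k(1) by linarith
    then have "Suc k mod length xs < length xs" "(n + k) mod length xs < length xs"
      by (simp_all add: mod_less_divisor)
    ultimately show "e \<in> cycle_arcs xs"
      unfolding cycle_arcs_def
      by (auto simp: nth_rotate mod_simps intro!: exI[of _ "(n + k) mod length xs"])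
  qed
  let ?n = "n mod length xs"
  have "rotate (length xs - ?n) (rotate n xs) = xs"
  proof (cases "xs = []")
    case False
    then have "?n < length xs" by simp
    then have "rotate (length xs - ?n) (rotate ?n xs) = xs"
      by (simp add: rotate_rotate)
    then show ?thesis by (metis rotate_conv_mod)
  qed simp
  then show ?thesis using sub[of n xs] sub[of "length xs - ?n" "rotate n xs"] by auto
qed

text \<open>
  Any arc of a cycle may be taken to be its closing arc; with the invariance of the arcs under
  rotation, the other arcs then join consecutive positions, without reduction modulo the length.
\<close>

lemma cycle_arc_last:
  assumes "(u, v) \<in> cycle_arcs xs"
  obtains n where "u = rotate n xs ! (length xs - 1)" "v = rotate n xs ! 0"
proof -
  from assms obtain k where k: "k < length xs" "u = xs ! k" "v = xs ! (Suc k mod length xs)"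
    by (auto simp: cycle_arcs_def)
  have "Suc k + (length xs - 1) = k + length xs" using k(1) by simp
  then have "(Suc k + (length xs - 1)) mod length xs = k" using k(1) by simp
  then have "u = rotate (Suc k) xs ! (length xs - 1)" using k by (subst nth_rotate) auto
  moreover have "v = rotate (Suc k) xs ! 0" using k by (subst nth_rotate) auto
  ultimately show thesis by (rule that)
qed

text \<open>
  Going along the cycle from \<open>v\<close> to \<open>u\<close> without the closing arc alternates the colours an even number
  of times.
\<close>

lemma two_coloring_odd_cycle:
  assumes \<kappa>: "two_coloring T \<kappa>" and xs: "cycle_in (T \<union> {(u, v), (v, u)}) xs" "odd (length xs)"
    and uv: "(u, v) \<in> cycle_arcs xs"
  shows "\<kappa> u = \<kappa> v"
proof -
  from uv obtain n where n: "u = rotate n xs ! (length xs - 1)" "v = rotate n xs ! 0"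
    by (rule cycle_arc_last)
  define ys where "ys = rotate n xs"
  define m where "m = length xs"
  have ys: "length ys = m" "distinct ys" "3 \<le> m" "cycle_arcs ys \<subseteq> T \<union> {(u, v), (v, u)}"
    "u = ys ! (m - 1)" "v = ys ! 0"
    using xs n by (auto simp: ys_def m_def cycle_in_def cycle_arcs_rotate)
  have arc: "(ys ! i, ys ! Suc i) \<in> T" if "Suc i < m" for i
  proof -
    have "(ys ! i, ys ! (Suc i mod length ys)) \<in> cycle_arcs ys"
      using that ys(1) unfolding cycle_arcs_def by (intro CollectI exI[of _ i]) simp
    then have "(ys ! i, ys ! Suc i) \<in> T \<union> {(u, v), (v, u)}"
      using that ys(1,4) by auto
    moreover have "ys ! i \<noteq> u"
      using that ys by (auto simp: nth_eq_iff_index_eq)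
    moreover have "\<not> (ys ! i = v \<and> ys ! Suc i = u)"
      using that ys by (auto simp: nth_eq_iff_index_eq)
    ultimately show ?thesis by auto
  qed
  have "i < m \<Longrightarrow> \<kappa> (ys ! i) = (- 1) ^ i * \<kappa> v" for i
  proof (induction i)
    case (Suc i)
    then show ?case using two_coloringD[OF \<kappa> arc[of i]] by simp
  qed (use ys in simp)
  from this[of "m - 1"] show ?thesis using ys xs(2) by (simp add: m_def)
qed

text \<open>
  The two-colouring vanishes in sum over every old edge, but not over the new one. This covers both
  kinds of extra edge: a self-loop is the case \<open>a = b\<close>.
\<close>

lemma edges_isolable_insert_monochromatic:
  assumes "edges_isolable T" and \<kappa>: "two_coloring T \<kappa>" and "\<kappa> a = \<kappa> b"
  shows "edges_isolable (T \<union> {(a, b), (b, a)})"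
proof (rule edges_isolable_insert)
  have \<kappa>0: "\<kappa> a \<noteq> 0" using two_coloring_nonzero[OF \<kappa>] .
  have "(a, b) \<notin> T" "(b, a) \<notin> T"
    using two_coloringD[OF \<kappa>, of a b] two_coloringD[OF \<kappa>, of b a] \<open>\<kappa> a = \<kappa> b\<close> \<kappa>0 by auto
  show "isolates (T \<union> {(a, b), (b, a)}) (\<lambda>x. \<kappa> x / (2 * \<kappa> a)) a b"
  proof (rule isolatesI)
    fix x y assume "(x, y) \<in> T \<union> {(a, b), (b, a)}"
    then consider "(x, y) = (a, b)" | "(x, y) = (b, a)"
      | "(x, y) \<in> T" "\<not> ((x, y) = (a, b) \<or> (x, y) = (b, a))"
      using \<open>(a, b) \<notin> T\<close> \<open>(b, a) \<notin> T\<close> by blast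
    then show "\<kappa> x / (2 * \<kappa> a) + \<kappa> y / (2 * \<kappa> a) = of_bool ((x, y) = (a, b) \<or> (x, y) = (b, a))"
    proof cases
      case 3
      then show ?thesis using two_coloringD[OF \<kappa> 3(1)] by simp
    qed (use \<open>\<kappa> a = \<kappa> b\<close> \<kappa>0 in simp_all)
  qed
qed fact

text \<open>
  On a cycle with an odd number of nodes, values alternating between \<open>1/2\<close> and \<open>-1/2\<close> from node to node
  cancel on all edges but one, where they add up to \<open>1\<close>.
\<close>

lemma odd_cycle_isolable:
  assumes "odd_cycle_graph V E"
  shows "edges_isolable E"
proof -
  from assms obtain xs where xs: "3 \<le> length xs" "distinct xs" "odd (length xs)"
    and E: "E = cycle_arcs xs \<union> (cycle_arcs xs)\<inverse>"
    by (auto simp: odd_cycle_graph_def)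
  have iso: "\<exists>\<sigma>. isolates E \<sigma> u v" if "(u, v) \<in> cycle_arcs xs" for u v
  proof -
    from that obtain n where n: "u = rotate n xs ! (length xs - 1)" "v = rotate n xs ! 0"
      by (rule cycle_arc_last)
    define ys where "ys = rotate n xs"
    define m where "m = length xs"
    have ys: "length ys = m" "distinct ys" "3 \<le> m" "odd m" "u = ys ! (m - 1)" "v = ys ! 0"
      and E': "E = cycle_arcs ys \<union> (cycle_arcs ys)\<inverse>"
      using xs n E by (auto simp: ys_def m_def cycle_arcs_rotate)
    \<comment> \<open>The description picks the position of \<open>x\<close> in the cycle.\<close>
    define \<sigma> :: "'a \<Rightarrow> real" where "\<sigma> x = (- 1) ^ (THE i. i < m \<and> ys ! i = x) / 2" for x
    have \<sigma>: "\<sigma> (ys ! i) = (- 1) ^ i / 2" if "i < m" for i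
    proof -
      have "(THE j. j < m \<and> ys ! j = ys ! i) = i"
        using that ys by (auto simp: nth_eq_iff_index_eq)
      then show ?thesis by (simp add: \<sigma>_def)
    qed
    have sum: "\<sigma> x + \<sigma> y = of_bool ((x, y) = (u, v) \<or> (x, y) = (v, u))"
      if "(x, y) \<in> cycle_arcs ys" for x y
    proof -
      from that obtain k where k: "k < m" "x = ys ! k" "y = ys ! (Suc k mod m)"
        using ys(1) by (auto simp: cycle_arcs_def)
      show ?thesis
      proof (cases "k = m - 1")
        case True
        then show ?thesis using k ys \<sigma>[of "m - 1"] \<sigma>[of 0] by auto
      next
        case False
        then have "Suc k < m" using k by simp
        moreover have "\<not> ((x, y) = (u, v) \<or> (x, y) = (v, u))"
        proof -
          have idx: "ys ! i = ys ! j \<longleftrightarrow> i = j" if "i < m" "j < m" for i j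
            using that ys(1,2) by (simp add: nth_eq_iff_index_eq)
          have xy: "x = ys ! k" "y = ys ! Suc k" using k \<open>Suc k < m\<close> by simp_all
          have "x \<noteq> u" unfolding xy ys(5) using idx[of k "m - 1"] k(1) False by linarith
          moreover have "\<not> (x = v \<and> y = u)"
            unfolding xy ys(5,6) using idx[of k 0] idx[of "Suc k" "m - 1"] k(1) \<open>Suc k < m\<close> ys(3)
            by linarith
          ultimately show ?thesis by blast
        qed
        moreover have "\<sigma> x + \<sigma> y = 0"
        proof -
          have "y = ys ! Suc k" using k(3) \<open>Suc k < m\<close> by simp
          then show ?thesis by (simp add: k(2) \<sigma>[OF k(1)] \<sigma>[OF \<open>Suc k < m\<close>])
        qed
        ultimately show ?thesis by (simp only: of_bool_eq if_False simp_thms)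
      qed
    qed
    have "isolates E \<sigma> u v"
    proof (rule isolatesI)
      fix x y assume "(x, y) \<in> E"
      then have "(x, y) \<in> cycle_arcs ys \<or> (y, x) \<in> cycle_arcs ys" by (auto simp: E')
      then show "\<sigma> x + \<sigma> y = of_bool ((x, y) = (u, v) \<or> (x, y) = (v, u))"
      proof
        assume "(y, x) \<in> cycle_arcs ys"
        from sum[OF this] show ?thesis by (simp add: add.commute conj_commute disj_commute)
      qed (rule sum)
    qed
    then show ?thesis by blast
  qed
  show ?thesis
    unfolding edges_isolable_def
  proof (intro allI impI)
    fix u v assume "(u, v) \<in> E"
    then show "\<exists>\<sigma>. isolates E \<sigma> u v"
      using iso[of u v] iso[of v u] isolates_swap[of E _ v u] by (auto simp: E)
  qed
qed

lemma tree_isolable_two_coloring: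
  assumes "tree_graph V T"
  shows "edges_isolable T \<and> (\<exists>\<kappa>. two_coloring T \<kappa>)"
proof (rule forest_isolable_two_coloring)
  show "finite T"
    using assms by (auto simp: tree_graph_def simple_graph_def multigraph_def intro: finite_subset)
qed (use assms in \<open>auto simp: tree_graph_def simple_graph_def multigraph_def\<close>)

lemma unicyclic_or_tree_isolable:
  assumes "odd_cycle_graph V E \<or> tree_graph V E \<or> tree_plus_odd_edge V E \<or> tree_plus_self_loop V E"
  shows "edges_isolable E"
  using assms
proof (elim disjE)
  assume "tree_plus_odd_edge V E"
  then obtain T u v xs where "tree_graph V T" "E = T \<union> {(u, v), (v, u)}"
    "cycle_in E xs" "odd (length xs)" "(u, v) \<in> cycle_arcs xs"
    unfolding tree_plus_odd_edge_def by blast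
  then show ?thesis
    using tree_isolable_two_coloring two_coloring_odd_cycle edges_isolable_insert_monochromatic
    by metis
next
  assume "tree_plus_self_loop V E"
  then obtain T u where "tree_graph V T" "E = T \<union> {(u, u), (u, u)}"
    by (auto simp: tree_plus_self_loop_def)
  then show ?thesis
    using tree_isolable_two_coloring edges_isolable_insert_monochromatic by metis
qed (use tree_isolable_two_coloring odd_cycle_isolable in blast)+


section \<open>Streams of i.i.d. variables\<close>

lemma (in prob_space) distr_snth: "distr (stream_space M) M (\<lambda>\<omega>. \<omega> !! k) = M"
proof -
  interpret P: product_prob_space "\<lambda>_::nat. M" UNIV ..
  have "distr (stream_space M) M (\<lambda>\<omega>. \<omega> !! k)
      = distr (\<Pi>\<^sub>M i\<in>UNIV. M) M (\<lambda>X. to_stream X !! k)"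
    by (subst stream_space_eq_distr) (simp add: distr_distr comp_def)
  also have "\<dots> = M" using P.PiM_component[of k] by (simp add: to_stream_def)
  finally show ?thesis .
qed

lemma (in prob_space) indep_vars_stream:
  assumes h: "h \<in> borel_measurable M"
  shows "prob_space.indep_vars (stream_space M) (\<lambda>_. borel) (\<lambda>k \<omega>. h (\<omega> !! k) :: real) UNIV"
proof -
  interpret S: prob_space "stream_space M" by (rule prob_space_stream_space)
  have "distr (stream_space M) (\<Pi>\<^sub>M i\<in>UNIV. M) (\<lambda>\<omega>. \<lambda>k\<in>UNIV. \<omega> !! k)
      = distr (\<Pi>\<^sub>M i\<in>UNIV. M) (\<Pi>\<^sub>M i\<in>UNIV. M) (\<lambda>X k. to_stream X !! k)"
    by (subst stream_space_eq_distr)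
       (simp add: distr_distr comp_def measurable_snth_PiM restrict_UNIV)
  also have "\<dots> = (\<Pi>\<^sub>M i\<in>UNIV. M)"
    by (simp add: to_stream_def distr_id)
  finally have "S.indep_vars (\<lambda>_. M) (\<lambda>k \<omega>. \<omega> !! k) (UNIV :: nat set)"
    by (subst S.indep_vars_iff_distr_eq_PiM) (simp_all add: distr_snth)
  then show ?thesis
    by (rule S.indep_vars_compose2) (simp add: h)
qed

text \<open>
  Hoeffding's inequality bounds the probability of a deviation by more than \<open>1 / (m + 1)\<close> geometrically
  in \<open>n\<close>, so that the Borel--Cantelli lemma applies.
\<close>

lemma (in prob_space) strong_law_bounded:
  fixes h :: "'a \<Rightarrow> real"
  assumes h[measurable]: "h \<in> borel_measurable M" and B: "\<And>x. x \<in> space M \<Longrightarrow> \<bar>h x\<bar> \<le> B"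
  shows "AE \<omega> in stream_space M. (\<lambda>n. (\<Sum>k<n. h (\<omega> !! k)) / real n) \<longlonglongrightarrow> expectation h"
proof -
  interpret S: prob_space "stream_space M" by (rule prob_space_stream_space)
  \<comment> \<open>A positive bound, as Hoeffding's inequality asks for intervals that are not points.\<close>
  define C where "C = max B 1"
  have C: "0 < C" "\<And>x. x \<in> space M \<Longrightarrow> - C \<le> h x \<and> h x \<le> C"
    using B by (fastforce simp: C_def abs_le_iff max_def)+
  define A where "A m n = {\<omega> \<in> space (stream_space M).
      real n / real (Suc m) \<le> \<bar>(\<Sum>k<n. h (\<omega> !! k)) - real n * expectation h\<bar>}" for m n :: nat
  have A[measurable]: "A m n \<in> sets (stream_space M)" for m n
    unfolding A_def by measurable
  have expect: "S.expectation (\<lambda>\<omega>. h (\<omega> !! k)) = expectation h" for k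
  proof -
    have "expectation h = (\<integral>x. h x \<partial>distr (stream_space M) M (\<lambda>\<omega>. \<omega> !! k))"
      by (simp add: distr_snth)
    then show ?thesis by (simp add: integral_distr)
  qed
  have small: "measure (stream_space M) (A m n)
      \<le> 2 * exp (- 1 / (2 * (real (Suc m))\<^sup>2 * C\<^sup>2)) ^ n" if "0 < n" for m n
  proof -
    interpret H: Hoeffding_ineq "stream_space M" "{..<n}" "\<lambda>k \<omega>. h (\<omega> !! k)" "\<lambda>_. - C" "\<lambda>_. C"
        "\<Sum>k<n. S.expectation (\<lambda>\<omega>. h (\<omega> !! k))"
    proof unfold_locales
      show "S.indep_vars (\<lambda>_. borel) (\<lambda>k \<omega>. h (\<omega> !! k)) {..<n}"
        by (rule S.indep_vars_subset[OF indep_vars_stream[OF h]]) simp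
      show "AE \<omega> in stream_space M. h (\<omega> !! k) \<in> {- C..C}" for k
        using C(2) by (intro AE_I2) (auto simp: space_stream_space snth_in)
    qed simp_all
    have "measure (stream_space M) (A m n)
        \<le> 2 * exp (- 2 * (real n / real (Suc m))\<^sup>2 / (\<Sum>k<n. (C - - C)\<^sup>2))"
      using H.Hoeffding_ineq_abs_ge[of "real n / real (Suc m)"] C(1) that
      by (simp add: A_def expect)
    also have "- 2 * (real n / real (Suc m))\<^sup>2 / (\<Sum>k<n. (C - - C)\<^sup>2)
        = real n * (- 1 / (2 * (real (Suc m))\<^sup>2 * C\<^sup>2))"
      using C(1) that by (simp add: field_simps power2_eq_square del: of_nat_Suc)
    also have "exp \<dots> = exp (- 1 / (2 * (real (Suc m))\<^sup>2 * C\<^sup>2)) ^ n"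
      by (rule exp_of_nat_mult)
    finally show ?thesis .
  qed
  have "AE \<omega> in stream_space M. \<forall>m. eventually (\<lambda>n. \<omega> \<in> space (stream_space M) - A m n) sequentially"
    unfolding AE_all_countable
  proof
    fix m
    let ?q = "exp (- 1 / (2 * (real (Suc m))\<^sup>2 * C\<^sup>2)) :: real"
    have "summable (\<lambda>n. 2 * ?q ^ n)"
      using C(1) by (intro summable_mult summable_geometric) (simp del: of_nat_Suc)
    then have "summable (\<lambda>n. measure (stream_space M) (A m n))"
      by (rule summable_comparison_test_ev[rotated])
         (use small in \<open>auto intro!: eventually_mono[OF eventually_gt_at_top[of 0]]\<close>)
    then show "AE \<omega> in stream_space M. eventually (\<lambda>n. \<omega> \<in> space (stream_space M) - A m n) sequentially"
      by (intro borel_cantelli_AE1) (simp_all add: S.emeasure_eq_measure)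
  qed
  then show ?thesis
  proof eventually_elim
    case (elim \<omega>)
    show ?case
    proof (rule LIMSEQ_I)
      fix r :: real assume "0 < r"
      then obtain m where m: "inverse (real (Suc m)) < r"
        using reals_Archimedean by blast
      from elim[rule_format, of m] obtain N where
        N: "\<And>n. N \<le> n \<Longrightarrow> \<omega> \<in> space (stream_space M) - A m n"
        by (auto simp: eventually_sequentially)
      have "norm ((\<Sum>k<n. h (\<omega> !! k)) / real n - expectation h) < r" if "Suc N \<le> n" for n
      proof -
        from N[of n] that have "\<bar>(\<Sum>k<n. h (\<omega> !! k)) - real n * expectation h\<bar> < real n / real (Suc m)"
          by (auto simp: A_def)
        then have "\<bar>(\<Sum>k<n. h (\<omega> !! k)) - real n * expectation h\<bar> / real n < inverse (real (Suc m))"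
          using that by (simp add: field_simps del: of_nat_Suc)
        moreover have "norm ((\<Sum>k<n. h (\<omega> !! k)) / real n - expectation h)
            = \<bar>(\<Sum>k<n. h (\<omega> !! k)) - real n * expectation h\<bar> / real n"
        proof -
          have "(\<Sum>k<n. h (\<omega> !! k)) / real n - expectation h
              = ((\<Sum>k<n. h (\<omega> !! k)) - real n * expectation h) / real n"
            using that by (simp add: diff_divide_distrib)
          then show ?thesis by (simp add: abs_divide)
        qed
        ultimately show ?thesis using m by linarith
      qed
      then show "\<exists>no. \<forall>n\<ge>no. norm ((\<Sum>k<n. h (\<omega> !! k)) / real n - expectation h) < r"
        by blast
    qed
  qed
qed

lemma (in prob_space) nn_integral_sdrop:
  assumes f[measurable]: "f \<in> borel_measurable (stream_space M)"
  shows "(\<integral>\<^sup>+\<omega>. f (sdrop n \<omega>) \<partial>stream_space M) = (\<integral>\<^sup>+\<omega>. f \<omega> \<partial>stream_space M)"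
proof (induction n)
  case (Suc n)
  have "(\<integral>\<^sup>+\<omega>. f (sdrop (Suc n) \<omega>) \<partial>stream_space M)
      = (\<integral>\<^sup>+x. (\<integral>\<^sup>+\<omega>. f (sdrop n \<omega>) \<partial>stream_space M) \<partial>M)"
    by (subst nn_integral_stream_space) simp_all
  also have "\<dots> = (\<integral>\<^sup>+\<omega>. f \<omega> \<partial>stream_space M)"
    by (simp add: Suc emeasure_space_1)
  finally show ?case .
qed simp

lemma (in prob_space) emeasure_sdrop:
  assumes A[measurable]: "A \<in> sets (stream_space M)"
  shows "emeasure (stream_space M) {\<omega> \<in> space (stream_space M). sdrop n \<omega> \<in> A} = emeasure (stream_space M) A"
proof -
  have "emeasure (stream_space M) {\<omega> \<in> space (stream_space M). sdrop n \<omega> \<in> A}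
      = (\<integral>\<^sup>+\<omega>. indicator A (sdrop n \<omega>) \<partial>stream_space M)"
  proof (subst nn_integral_indicator[symmetric])
    show "(\<integral>\<^sup>+\<omega>. indicator {\<omega> \<in> space (stream_space M). sdrop n \<omega> \<in> A} \<omega> \<partial>stream_space M)
        = (\<integral>\<^sup>+\<omega>. indicator A (sdrop n \<omega>) \<partial>stream_space M)"
      by (rule nn_integral_cong) (simp split: split_indicator)
  qed measurable
  then show ?thesis by (simp add: nn_integral_sdrop)
qed

lemma suminf_of_nat_less:
  "(\<Sum>n. if (of_nat n :: ennreal) < of_nat k then 1 else 0) = (of_nat k :: ennreal)"
proof -
  have "(\<Sum>n. if (of_nat n :: ennreal) < of_nat k then 1 else 0)
      = (\<Sum>n<k. if (of_nat n :: ennreal) < of_nat k then 1 else 0 :: ennreal)"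
    by (rule suminf_finite) (auto simp: not_less)
  also have "\<dots> = (\<Sum>n<k. 1)" by (rule sum.cong) auto
  finally show ?thesis by simp
qed


section \<open>Positive recurrent random recursions\<close>

lemma return_time_attained:
  assumes "return_time f s \<omega> < \<infinity>"
  obtains k where "1 \<le> k" "trajectory f s \<omega> k = s" "return_time f s \<omega> = of_nat k"
proof -
  let ?A = "{n. 1 \<le> n \<and> trajectory f s \<omega> n = s}"
  have "?A \<noteq> {}"
  proof
    assume "?A = {}"
    then have "return_time f s \<omega> = \<top>" unfolding return_time_def by (simp only: image_empty Inf_empty)
    with assms show False by simp
  qed
  then have A: "Inf ?A \<in> ?A" by (rule Inf_nat_def1)
  have "return_time f s \<omega> = of_nat (Inf ?A)"
    unfolding return_time_def
  proof (rule antisym)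
    show "(INF n\<in>?A. of_nat n :: ennreal) \<le> of_nat (Inf ?A)" using A by (rule INF_lower)
    show "of_nat (Inf ?A) \<le> (INF n\<in>?A. of_nat n :: ennreal)"
      by (rule INF_greatest) (metis (no_types, lifting) cInf_lower bdd_below_bot of_nat_le_iff of_nat_mono)
  qed
  with A show thesis by (intro that[of "Inf ?A"]) auto
qed

lemma trajectory_shift:
  "trajectory f s \<omega> (n + k) = trajectory f (trajectory f s \<omega> n) (sdrop n \<omega>) k"
  by (induction k) (simp_all add: sdrop_snth)

text \<open>
  Late excursions from \<open>s\<close> are short compared with the time at which they start. Since a step changes
  \<open>g\<close> by a bounded amount, \<open>g\<close> is then small, compared with the time, throughout such an excursion.
\<close>

lemma sublinear_of_short_excursions:
  fixes g :: "'s \<Rightarrow> real"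
  assumes start: "X 0 = s"
    and returns: "\<And>n. X n = s \<Longrightarrow> \<exists>k\<ge>1. X (n + k) = s"
    and short: "\<And>m. eventually (\<lambda>n. X n = s \<longrightarrow> (\<exists>k\<ge>1. X (n + k) = s \<and> m * k \<le> n)) sequentially"
    and incr: "\<And>n. \<bar>g (X (Suc n)) - g (X n)\<bar> \<le> c"
  shows "(\<lambda>n. g (X n) / real n) \<longlonglongrightarrow> 0"
proof (rule LIMSEQ_I)
  fix r :: real assume "0 < r"
  have c: "0 \<le> c" using incr[of 0] by linarith
  have dist: "\<bar>g (X (l + k))\<bar> \<le> \<bar>g (X l)\<bar> + c * real k" for l k
  proof (induction k)
    case (Suc k)
    then show ?case using incr[of "l + k"] by (simp add: algebra_simps)
  qed simp
  \<comment> \<open>An excursion shorter than \<open>n / m\<close> contributes at most \<open>c * n / m < r * n / 2\<close>; the initial value \<open>g s\<close> accounts for the rest.\<close>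
  obtain m :: nat where m: "2 * c / r < real m" using reals_Archimedean2 by blast
  then have m0: "0 < m" using c \<open>0 < r\<close> by (cases m) (auto simp: field_simps)
  have cm: "c / real m < r / 2" using m m0 \<open>0 < r\<close> by (simp add: field_simps)
  obtain N where N: "\<And>n. N \<le> n \<Longrightarrow> X n = s \<Longrightarrow> \<exists>k\<ge>1. X (n + k) = s \<and> m * k \<le> n"
    using short[of m] by (auto simp: eventually_sequentially)
  have "\<exists>n\<ge>M. X n = s" for M
  proof (induction M)
    case 0
    then show ?case using start by blast
  next
    case (Suc M)
    then obtain n where n: "M \<le> n" "X n = s" by blast
    with returns[of n] obtain k where "1 \<le> k" "X (n + k) = s" by blast
    with n show ?case by (intro exI[of _ "n + k"]) auto
  qed
  then obtain l0 where l0: "N \<le> l0" "X l0 = s" by blast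
  obtain K :: nat where K: "2 * \<bar>g s\<bar> / r < real K" using reals_Archimedean2 by blast
  have "norm (g (X n) / real n - 0) < r" if n: "Suc (max l0 K) \<le> n" for n
  proof -
    \<comment> \<open>The last visit to \<open>s\<close> up to time \<open>n\<close>; the next one comes after \<open>n\<close>.\<close>
    define l where "l = Max {i. i \<le> n \<and> X i = s}"
    have fin: "finite {i. i \<le> n \<and> X i = s}" by simp
    have "l0 \<in> {i. i \<le> n \<and> X i = s}" using l0 n by simp
    then have "l \<in> {i. i \<le> n \<and> X i = s}" and "l0 \<le> l"
        unfolding l_def using fin Max_in Max_ge by blast+
    then have l: "l \<le> n" "X l = s" "N \<le> l" using l0 by auto
    from N[OF l(3,2)] obtain k where k: "1 \<le> k" "X (l + k) = s" "m * k \<le> l" by blast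
    have "n < l + k"
    proof (rule ccontr)
      assume "\<not> n < l + k"
      then have "l + k \<le> l" unfolding l_def using k fin by (intro Max_ge) (auto simp: l_def)
      then show False using k(1) by simp
    qed
    then have "m * (n - l) \<le> m * k" by (intro mult_le_mono2) simp
    also have "\<dots> \<le> n" using k(3) l(1) by simp
    finally have "real m * real (n - l) \<le> real n" by (metis of_nat_le_iff of_nat_mult)
    then have "c * real (n - l) \<le> c / real m * real n"
      using c m0 by (simp add: field_simps mult_left_mono)
    moreover have "\<bar>g (X n)\<bar> \<le> \<bar>g s\<bar> + c * real (n - l)"
      using dist[of l "n - l"] l by simp
    moreover have "c / real m * real n < r / 2 * real n"
      using cm n by (intro mult_strict_right_mono) auto
    moreover have "\<bar>g s\<bar> < r / 2 * real n"
    proof -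
      have "2 * \<bar>g s\<bar> / r < real n" using K n by linarith
      then show ?thesis using \<open>0 < r\<close> by (simp add: field_simps)
    qed
    ultimately have "\<bar>g (X n)\<bar> < r * real n" by linarith
    then show ?thesis using n by (simp add: field_simps)
  qed
  then show "\<exists>no. \<forall>n\<ge>no. norm (g (X n) / real n - 0) < r" by blast
qed

text \<open>
  As there are countably many states, it suffices to have measurability in the input, state by state.
\<close>

locale random_recursion = prob_space M for M :: "'x measure" +
  fixes f :: "'s \<Rightarrow> 'x \<Rightarrow> 's \<times> ('a \<times> 'a) list" and S :: "'s set"
  assumes countable_states: "countable S"
    and step_measurable: "s \<in> S \<Longrightarrow> (\<lambda>x. fst (f s x)) \<in> M \<rightarrow>\<^sub>M count_space S"
begin

lemma trajectory_measurable:
  assumes "s \<in> S"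
  shows "(\<lambda>\<omega>. trajectory f s \<omega> n) \<in> stream_space M \<rightarrow>\<^sub>M count_space S"
proof (induction n)
  case (Suc n)
  have "(\<lambda>\<omega>. fst (f t (\<omega> !! n))) \<in> stream_space M \<rightarrow>\<^sub>M count_space S" if "t \<in> S" for t
    using measurable_compose[OF measurable_snth step_measurable[OF that]] .
  from measurable_compose_countable'[OF this Suc countable_states] show ?case by simp
qed (use assms in simp)

lemma trajectory_in_states:
  "s \<in> S \<Longrightarrow> \<omega> \<in> space (stream_space M) \<Longrightarrow> trajectory f s \<omega> n \<in> S"
  using measurable_space[OF trajectory_measurable] by simp

lemma return_time_measurable:
  assumes "s \<in> S"
  shows "return_time f s \<in> borel_measurable (stream_space M)"
proof -
  have [measurable]: "Measurable.pred (stream_space M) (\<lambda>\<omega>. trajectory f s \<omega> n = s)" for n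
    by (rule measurable_compose[OF trajectory_measurable[OF assms, of n], of "\<lambda>t. t = s"]) simp
  have "return_time f s = (\<lambda>\<omega>. INF n. if 1 \<le> n \<and> trajectory f s \<omega> n = s then of_nat n else \<top>)"
  proof
    fix \<omega>
    show "return_time f s \<omega> = (INF n. if 1 \<le> n \<and> trajectory f s \<omega> n = s then of_nat n else \<top>)"
      unfolding return_time_def
    proof (rule antisym)
      show "(INF n\<in>{n. 1 \<le> n \<and> trajectory f s \<omega> n = s}. of_nat n)
          \<le> (INF n. if 1 \<le> n \<and> trajectory f s \<omega> n = s then of_nat n else \<top> :: ennreal)"
        by (rule INF_greatest) (auto intro: INF_lower)
      show "(INF n. if 1 \<le> n \<and> trajectory f s \<omega> n = s then of_nat n else \<top> :: ennreal)
          \<le> (INF n\<in>{n. 1 \<le> n \<and> trajectory f s \<omega> n = s}. of_nat n)"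
      proof (rule INF_greatest)
        fix n assume "n \<in> {n. 1 \<le> n \<and> trajectory f s \<omega> n = s}"
        then show "(INF n. if 1 \<le> n \<and> trajectory f s \<omega> n = s then of_nat n else \<top> :: ennreal) \<le> of_nat n"
          by (intro INF_lower2[of n]) auto
      qed
    qed
  qed
  then show ?thesis by (simp only:) measurable
qed

text \<open>
  The bound concerns the chain restarted from \<open>s\<close> at time \<open>n\<close>, whether or not it is in state \<open>s\<close>
  at that time. By shift invariance, the probability that it fails is that of a return time exceeding
  \<open>n / m\<close>, and the sum of these tails is the mean of a multiple of the return time, which is finite.
  The Borel--Cantelli lemma concludes.
\<close>

lemma AE_short_excursions:
  assumes rec: "positive_recurrent M f S" and s: "s \<in> S"
  shows "AE \<omega> in stream_space M.
    \<forall>m. eventually (\<lambda>n. of_nat m * return_time f s (sdrop n \<omega>) \<le> of_nat n) sequentially"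
  unfolding AE_all_countable
proof
  fix m :: nat
  interpret S: prob_space "stream_space M" by (rule prob_space_stream_space)
  note [measurable] = return_time_measurable[OF s]
  define A where "A n = {\<omega> \<in> space (stream_space M). of_nat n < of_nat m * return_time f s \<omega>}" for n :: nat
  define B where "B n = {\<omega> \<in> space (stream_space M). sdrop n \<omega> \<in> A n}" for n :: nat
  have [measurable]: "A n \<in> sets (stream_space M)" "B n \<in> sets (stream_space M)" for n
    unfolding A_def B_def by measurable
  have fin: "(\<integral>\<^sup>+\<omega>. return_time f s \<omega> \<partial>stream_space M) < \<infinity>"
    using rec s by (simp add: positive_recurrent_def)
  have pointwise: "(\<Sum>n. if of_nat n < of_nat m * return_time f s \<omega> then 1 else 0)
      \<le> of_nat m * return_time f s \<omega>" for \<omega>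
  proof (cases "return_time f s \<omega> < \<infinity>")
    case True
    then obtain k where "return_time f s \<omega> = of_nat k" by (rule return_time_attained)
    then show ?thesis using suminf_of_nat_less[of "m * k"] by simp
  next
    case False
    then have "return_time f s \<omega> = \<top>" 
      using top.not_eq_extremum[of "return_time f s \<omega>"] by auto
    then show ?thesis by (cases "m = 0") (simp_all add: ennreal_mult_top)
  qed
  have "(\<Sum>n. emeasure (stream_space M) (A n))
      = (\<Sum>n. \<integral>\<^sup>+\<omega>. indicator (A n) \<omega> \<partial>stream_space M)"
    by simp
  also have "\<dots> = (\<integral>\<^sup>+\<omega>. (\<Sum>n. indicator (A n) \<omega>) \<partial>stream_space M)"
    by (rule nn_integral_suminf[symmetric]) simp
  also have "\<dots> = (\<integral>\<^sup>+\<omega>. (\<Sum>n. if of_nat n < of_nat m * return_time f s \<omega> then 1 else 0) \<partial>stream_space M)"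
    by (intro nn_integral_cong arg_cong[where f = suminf] ext) (simp add: A_def indicator_def)
  also have "\<dots> \<le> (\<integral>\<^sup>+\<omega>. of_nat m * return_time f s \<omega> \<partial>stream_space M)"
    by (intro nn_integral_mono pointwise)
  also have "\<dots> = of_nat m * (\<integral>\<^sup>+\<omega>. return_time f s \<omega> \<partial>stream_space M)"
    by (rule nn_integral_cmult) simp
  also have "\<dots> < \<infinity>" using fin by (simp add: ennreal_mult_less_top of_nat_less_top)
  finally have "(\<Sum>n. emeasure (stream_space M) (B n)) < \<infinity>"
    by (simp add: B_def emeasure_sdrop)
  then have "summable (\<lambda>n. measure (stream_space M) (B n))"
    by (intro summable_suminf_not_top) (simp_all add: S.emeasure_eq_measure)
  then have "AE \<omega> in stream_space M. eventually (\<lambda>n. \<omega> \<in> space (stream_space M) - B n) sequentially"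
    by (intro borel_cantelli_AE1) (simp_all add: S.emeasure_eq_measure)
  then show "AE \<omega> in stream_space M.
      eventually (\<lambda>n. of_nat m * return_time f s (sdrop n \<omega>) \<le> of_nat n) sequentially"
  proof eventually_elim
    case (elim \<omega>)
    then show ?case
    proof eventually_elim
      case (elim n)
      then have "sdrop n \<omega> \<in> space (stream_space M)" "sdrop n \<omega> \<notin> A n"
        using measurable_space[OF measurable_sdrop, of \<omega> M n] by (auto simp: B_def)
      then show ?case by (simp add: A_def not_less)
    qed
  qed
qed

lemma AE_finite_return:
  assumes rec: "positive_recurrent M f S" and s: "s \<in> S"
  shows "AE \<omega> in stream_space M. \<forall>n. return_time f s (sdrop n \<omega>) < \<infinity>"
  unfolding AE_all_countable
proof
  fix n
  note [measurable] = return_time_measurable[OF s]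
  have "(\<integral>\<^sup>+\<omega>. return_time f s (sdrop n \<omega>) \<partial>stream_space M) \<noteq> \<infinity>"
    using rec s by (auto simp: positive_recurrent_def nn_integral_sdrop)
  then have "AE \<omega> in stream_space M. return_time f s (sdrop n \<omega>) \<noteq> \<infinity>"
    by (rule nn_integral_PInf_AE[rotated]) measurable
  then show "AE \<omega> in stream_space M. return_time f s (sdrop n \<omega>) < \<infinity>"
    by eventually_elim (simp add: top.not_eq_extremum)
qed

text \<open>
  For \<open>g\<close> a function of the stored items this says that storage is negligible on the scale of time.
\<close>

lemma AE_sublinear:
  fixes g :: "'s \<Rightarrow> real"
  assumes rec: "positive_recurrent M f S" and s: "s \<in> S"
    and incr: "\<And>t x. t \<in> S \<Longrightarrow> x \<in> space M \<Longrightarrow> \<bar>g (fst (f t x)) - g t\<bar> \<le> c"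
  shows "AE \<omega> in stream_space M. (\<lambda>n. g (trajectory f s \<omega> n) / real n) \<longlonglongrightarrow> 0"
  using AE_short_excursions[OF rec s] AE_finite_return[OF rec s] AE_space
proof eventually_elim
  case (elim \<omega>)
  let ?X = "trajectory f s \<omega>"
  show ?case
  proof (rule sublinear_of_short_excursions[where X = ?X and s = s and c = c])
    show "?X 0 = s" by simp
    show "\<exists>k\<ge>1. ?X (n + k) = s" if "?X n = s" for n
    proof -
      from elim(2)[rule_format, of n] obtain k where "1 \<le> k" "trajectory f s (sdrop n \<omega>) k = s"
        by (rule return_time_attained)
      then show ?thesis using that by (auto simp: trajectory_shift)
    qed
    show "eventually (\<lambda>n. ?X n = s \<longrightarrow> (\<exists>k\<ge>1. ?X (n + k) = s \<and> m * k \<le> n)) sequentially" for m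
      using elim(1)[rule_format, of m]
    proof eventually_elim
      case bound: (elim n)
      show ?case
      proof
        assume X: "?X n = s"
        from elim(2)[rule_format, of n] obtain k where k: "1 \<le> k"
          "trajectory f s (sdrop n \<omega>) k = s" "return_time f s (sdrop n \<omega>) = of_nat k"
          by (rule return_time_attained)
        with bound have "(of_nat (m * k) :: ennreal) \<le> of_nat n" by simp
        then have "m * k \<le> n" by (simp only: of_nat_le_iff)
        with k X show "\<exists>k\<ge>1. ?X (n + k) = s \<and> m * k \<le> n" by (auto simp: trajectory_shift)
      qed
    qed
    show "\<bar>g (?X (Suc n)) - g (?X n)\<bar> \<le> c" for n
      using incr[OF trajectory_in_states[OF s elim(3), of n], of "\<omega> !! n"] elim(3)
      by (auto simp: space_stream_space snth_in)
  qed
qed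

text \<open>
  The balance equation says that \<open>h\<close> of the input either remains stored, where \<open>g\<close> records it, or is
  converted into a matching between \<open>i\<close> and \<open>j\<close>. Its telescoped sum expresses the number of these
  matchings through the sums of \<open>h\<close>, which obey the law of large numbers, up to a sublinear term.
  The rate is therefore the mean of \<open>h\<close>, in which the recursion \<open>f\<close> does not occur.
\<close>

theorem matching_rate_of_balance:
  fixes g :: "'s \<Rightarrow> real" and h :: "'x \<Rightarrow> real"
  assumes rec: "positive_recurrent M f S"
    and h: "h \<in> borel_measurable M" and B: "\<And>x. x \<in> space M \<Longrightarrow> \<bar>h x\<bar> \<le> B"
    and balance: "\<And>t x. t \<in> S \<Longrightarrow> x \<in> space M \<Longrightarrow>
      g (fst (f t x)) + real (length (filter (\<lambda>p. p = (i, j) \<or> p = (j, i)) (snd (f t x)))) = g t + h x"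
    and few: "\<And>t x. t \<in> S \<Longrightarrow> x \<in> space M \<Longrightarrow> length (snd (f t x)) \<le> N"
  shows "has_matching_rate M f S i j (expectation h)"
  unfolding has_matching_rate_def
proof
  fix s assume s: "s \<in> S"
  have "\<bar>g (fst (f t x)) - g t\<bar> \<le> B + real N" if "t \<in> S" "x \<in> space M" for t x
  proof -
    have "real (length (filter (\<lambda>p. p = (i, j) \<or> p = (j, i)) (snd (f t x)))) \<le> real N"
      using few[OF that] length_filter_le le_trans of_nat_le_iff by blast
    then show ?thesis using balance[OF that] B[OF that(2)] by linarith
  qed
  then have sub: "AE \<omega> in stream_space M. (\<lambda>n. g (trajectory f s \<omega> n) / real n) \<longlonglongrightarrow> 0"
    using AE_sublinear[OF rec s] by blast
  have law: "AE \<omega> in stream_space M. (\<lambda>n. (\<Sum>k<n. h (\<omega> !! k)) / real n) \<longlonglongrightarrow> expectation h"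
    using h B by (rule strong_law_bounded)
  show "AE \<omega> in stream_space M. (\<lambda>n. real (num_matchings f s \<omega> i j n) / real n) \<longlonglongrightarrow> expectation h"
    using sub law AE_space
  proof eventually_elim
    case (elim \<omega>)
    have num: "real (num_matchings f s \<omega> i j n)
        = g s - g (trajectory f s \<omega> n) + (\<Sum>k<n. h (\<omega> !! k))" for n
    proof (induction n)
      case (Suc n)
      then show ?case
        using balance[OF trajectory_in_states[OF s elim(3), of n], of "\<omega> !! n"] elim(3)
        by (simp add: num_matchings_def space_stream_space snth_in)
    qed (simp add: num_matchings_def)
    have "(\<lambda>n. g s / real n - g (trajectory f s \<omega> n) / real n + (\<Sum>k<n. h (\<omega> !! k)) / real n)
        \<longlonglongrightarrow> 0 - 0 + expectation h"
      by (intro tendsto_intros elim lim_const_over_n)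
    then show ?case by (simp add: num add_divide_distrib diff_divide_distrib)
  qed
qed

end


section \<open>Removal of stored items and laws of inputs\<close>

lemma sum_list_remove_nth:
  fixes \<sigma> :: "'a \<Rightarrow> real"
  assumes "k < length w"
  shows "sum_list (map \<sigma> (remove_nth k w)) = sum_list (map \<sigma> w) - \<sigma> (w ! k)"
proof -
  have "sum_list (map \<sigma> w) = sum_list (map \<sigma> (take k w @ w ! k # drop (Suc k) w))"
    using id_take_nth_drop[OF assms] by simp
  then show ?thesis by (simp add: remove_nth_def)
qed

lemma length_remove_nth: "k < length w \<Longrightarrow> length (remove_nth k w) = length w - 1"
  by (simp add: remove_nth_def)

lemma set_remove_nth: "set (remove_nth k w) \<subseteq> set w"
  using set_take_subset[of k w] set_drop_subset[of "Suc k" w] by (auto simp: remove_nth_def)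

lemma nth_remove_nth:
  "k < length w \<Longrightarrow> i < length w - 1 \<Longrightarrow>
    remove_nth k w ! i = w ! (if i < k then i else Suc i)"
  by (simp add: remove_nth_def nth_append)

lemma measurable_restrict_count_space:
  assumes "f \<in> M \<rightarrow>\<^sub>M count_space UNIV" and "f \<in> space M \<rightarrow> A"
  shows "f \<in> M \<rightarrow>\<^sub>M count_space A"
  using measurable_restrict_space2[OF assms(2,1)]
  by (simp add: restrict_count_space)

lemma prob_space_uniform_draw: "prob_space uniform_draw"
  unfolding uniform_draw_def by (rule prob_space_uniform_measure) simp_all

lemma sets_uniform_draw [measurable_cong]: "sets uniform_draw = sets borel"
  by (simp add: uniform_draw_def)

lemma space_uniform_draw: "space uniform_draw = UNIV"
  by (simp add: uniform_draw_def)

lemma abs_le_sum_abs: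
  fixes \<sigma> :: "'a \<Rightarrow> real"
  assumes "finite V" "v \<in> V"
  shows "\<bar>\<sigma> v\<bar> \<le> (\<Sum>u\<in>V. \<bar>\<sigma> u\<bar>)"
  using assms by (intro member_le_sum) auto

lemma length_filter_isolated:
  assumes "isolates E \<sigma> i j" "(a, b) \<in> E"
  shows "real (length (filter (\<lambda>p. p = (i, j) \<or> p = (j, i)) [(a, b)])) = \<sigma> a + \<sigma> b"
  unfolding isolatesD[OF assms] by simp

text \<open>
  Both input laws have this form: finitely many classes or couples of classes, with independent draws.
  Measurability may be checked class by class.
\<close>

lemma finite_product_law:
  assumes "finite A" and \<nu>: "\<nu> \<in> full_prob_measures A" and N: "prob_space N"
  defines "L \<equiv> point_measure A (\<lambda>a. ennreal (\<nu> a)) \<Otimes>\<^sub>M N"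
  shows prob_space_finite_product_law: "prob_space L"
    and space_finite_product_law: "space L = A \<times> space N"
    and measurable_finite_product_law:
      "(\<And>a. a \<in> A \<Longrightarrow> (\<lambda>y. F (a, y)) \<in> N \<rightarrow>\<^sub>M K) \<Longrightarrow> F \<in> L \<rightarrow>\<^sub>M K"
proof -
  have "0 \<le> \<nu> a" if "a \<in> A" for a
    using \<nu> that by (auto simp: full_prob_measures_def full_measures_def intro: less_imp_le)
  moreover have "sum \<nu> A = 1" using \<nu> by (simp add: full_prob_measures_def)
  ultimately have "prob_space (point_measure A (\<lambda>a. ennreal (\<nu> a)))"
    using \<open>finite A\<close> by (intro prob_space_point_measure) (simp_all add: sum_ennreal)
  then show "prob_space L" unfolding L_def using N by (rule prob_space_pair)
  show "space L = A \<times> space N"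
    by (simp add: L_def space_pair_measure space_point_measure)
  assume "\<And>a. a \<in> A \<Longrightarrow> (\<lambda>y. F (a, y)) \<in> N \<rightarrow>\<^sub>M K"
  then have "F \<in> count_space A \<Otimes>\<^sub>M N \<rightarrow>\<^sub>M K"
    using \<open>finite A\<close> by (intro measurable_pair_measure_countable1) (auto intro: countable_finite)
  also have "(count_space A \<Otimes>\<^sub>M N \<rightarrow>\<^sub>M K) = (L \<rightarrow>\<^sub>M K)"
    unfolding L_def by (intro measurable_cong_sets sets_pair_measure_cong) (simp_all add: sets_point_measure)
  finally show "F \<in> L \<rightarrow>\<^sub>M K" .
qed


section \<open>Rates in the general model\<close>

lemma step_cases:
  assumes "admissible V E \<Phi>" "w \<in> words V E" "v \<in> V"
  obtains (store) "compatible_positions E w v = {}" "step E \<Phi> w (v, r) = (w @ [v], [])"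
  | (match) k where "k < length w" "(w ! k, v) \<in> E" "step E \<Phi> w (v, r) = (remove_nth k w, [(w ! k, v)])"
proof (cases "compatible_positions E w v = {}")
  case True
  then show thesis by (intro store) simp_all
next
  case False
  then have "\<Phi> w v r \<in> compatible_positions E w v"
    using assms by (auto simp: admissible_def)
  then show thesis using False by (intro match[of "\<Phi> w v r"]) (auto simp: compatible_positions_def Let_def)
qed

lemma step_in_words:
  assumes G: "multigraph V E" and \<Phi>: "admissible V E \<Phi>" and w: "w \<in> words V E" and v: "v \<in> V"
  shows "fst (step E \<Phi> w (v, r)) \<in> words V E"
proof -
  have indep: "(w ! p, w ! q) \<notin> E" if "p < length w" "q < length w" "p \<noteq> q" for p q
    using w that by (auto simp: words_def)
  have wV: "set w \<subseteq> V" using w by (auto simp: words_def)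
  from \<Phi> w v show ?thesis
  proof (cases rule: step_cases[where r = r])
    case store
    have "(w ! p, v) \<notin> E" "(v, w ! p) \<notin> E" if "p < length w" for p
      using store(1) that G by (auto simp: compatible_positions_def multigraph_def dest: symD)
    then show ?thesis
      using store(2) wV v indep by (auto simp: words_def nth_append less_Suc_eq)
  next
    case (match k)
    have "(remove_nth k w ! p, remove_nth k w ! q) \<notin> E"
      if "p < length w - 1" "q < length w - 1" "p \<noteq> q" for p q
      unfolding nth_remove_nth[OF match(1) that(1)] nth_remove_nth[OF match(1) that(2)]
      using that by (intro indep) auto
    then show ?thesis
      using match wV set_remove_nth[of k w] by (auto simp: words_def length_remove_nth)
  qed
qed

lemma step_balance:
  assumes "admissible V E \<Phi>" "w \<in> words V E" "v \<in> V" and \<sigma>: "isolates E \<sigma> i j"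
  shows "sum_list (map \<sigma> (fst (step E \<Phi> w (v, r))))
      + real (length (filter (\<lambda>p. p = (i, j) \<or> p = (j, i)) (snd (step E \<Phi> w (v, r)))))
    = sum_list (map \<sigma> w) + \<sigma> v"
  using assms(1-3)
proof (cases rule: step_cases[where r = r])
  case (match k)
  show ?thesis
    unfolding match(3) fst_conv snd_conv length_filter_isolated[OF \<sigma> match(2)]
    by (simp add: sum_list_remove_nth[OF match(1)])
qed simp

text \<open>
  The rate of the edge between \<open>i\<close> and \<open>j\<close> is the mean of an isolating function under the law of the
  arrivals. The recorded quantity is the sum of this function over the stored word.
\<close>

lemma gen_policy_invariant_if_isolable:
  assumes G: "multigraph V E" and iso: "edges_isolable E"
  shows "gen_policy_invariant V E"
  unfolding gen_policy_invariant_def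
proof
  fix \<mu> assume "\<mu> \<in> ncond V E"
  let ?\<nu> = "normalize_measure V \<mu>"
  have finV: "finite V" using G by (simp add: multigraph_def)
  obtain pot where pot: "\<And>i j. (i, j) \<in> E \<Longrightarrow> isolates E (pot i j) i j"
    using iso unfolding edges_isolable_def by metis
  define \<theta> where "\<theta> i j = (\<integral>(v, r). pot i j v \<partial>input_law V ?\<nu>)" for i j
  show "\<exists>\<theta>. \<forall>\<Phi>. admissible V E \<Phi> \<longrightarrow> ?\<nu> \<in> stab V E \<Phi> \<longrightarrow>
      (\<forall>(i, j) \<in> E. asymptotic_matching_rate V E \<Phi> ?\<nu> i j (\<theta> i j))"
  proof (intro exI[of _ \<theta>] allI impI ballI, clarify)
    fix \<Phi> i j
    assume \<Phi>: "admissible V E \<Phi>" and stab: "?\<nu> \<in> stab V E \<Phi>" and "(i, j) \<in> E"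
    note \<sigma> = pot[OF \<open>(i, j) \<in> E\<close>]
    have \<nu>: "?\<nu> \<in> full_prob_measures V"
      and rec: "positive_recurrent (input_law V ?\<nu>) (step E \<Phi>) (words V E)"
      using stab by (auto simp: stab_def)
    note law = finite_product_law[OF finV \<nu> prob_space_uniform_draw, folded input_law_def]
    have space: "space (input_law V ?\<nu>) = V \<times> UNIV"
      by (simp add: law(2) space_uniform_draw)
    interpret prob_space "input_law V ?\<nu>" by (rule law(1))
    interpret random_recursion "input_law V ?\<nu>" "step E \<Phi>" "words V E"
    proof
      show "countable (words V E)"
        using countable_finite[OF finV]
        by (rule countable_subset[rotated, OF countable_lists]) (auto simp: words_def)
      fix w assume w: "w \<in> words V E"
      show "(\<lambda>x. fst (step E \<Phi> w x)) \<in> input_law V ?\<nu> \<rightarrow>\<^sub>M count_space (words V E)"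
      proof (rule measurable_restrict_count_space)
        show "(\<lambda>x. fst (step E \<Phi> w x)) \<in> input_law V ?\<nu> \<rightarrow>\<^sub>M count_space UNIV"
        proof (rule law(3))
          fix v assume "v \<in> V"
          with \<Phi> w have [measurable]: "\<Phi> w v \<in> borel \<rightarrow>\<^sub>M count_space UNIV"
            by (auto simp: admissible_def)
          have "fst (step E \<Phi> w (v, r)) = (if compatible_positions E w v = {} then w @ [v]
              else remove_nth (\<Phi> w v r) w)" for r
            by (simp add: Let_def)
          then show "(\<lambda>r. fst (step E \<Phi> w (v, r))) \<in> uniform_draw \<rightarrow>\<^sub>M count_space UNIV"
            by (simp only:) measurable
        qed
        show "(\<lambda>x. fst (step E \<Phi> w x)) \<in> space (input_law V ?\<nu>) \<rightarrow> words V E"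
          using step_in_words[OF G \<Phi> w] by (auto simp only: space Pi_iff mem_Times_iff split_paired_all fst_conv)
      qed
    qed
    show "asymptotic_matching_rate V E \<Phi> ?\<nu> i j (\<theta> i j)"
      unfolding asymptotic_matching_rate_def \<theta>_def
    proof (rule matching_rate_of_balance[OF rec,
          where g = "\<lambda>w. sum_list (map (pot i j) w)" and B = "\<Sum>u\<in>V. \<bar>pot i j u\<bar>" and N = 1])
      show "(\<lambda>(v, r). pot i j v) \<in> borel_measurable (input_law V ?\<nu>)"
        by (rule law(3)) simp
      fix x :: "'a \<times> real" assume x: "x \<in> space (input_law V ?\<nu>)"
      obtain v r where vr: "x = (v, r)" by (cases x)
      with x have v: "v \<in> V" by (simp add: space)
      show "\<bar>case x of (v, r) \<Rightarrow> pot i j v\<bar> \<le> (\<Sum>u\<in>V. \<bar>pot i j u\<bar>)"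
        using abs_le_sum_abs[OF finV v] by (simp add: vr)
      fix w assume w: "w \<in> words V E"
      show "sum_list (map (pot i j) (fst (step E \<Phi> w x)))
          + real (length (filter (\<lambda>p. p = (i, j) \<or> p = (j, i)) (snd (step E \<Phi> w x))))
          = sum_list (map (pot i j) w) + (case x of (v, r) \<Rightarrow> pot i j v)"
        unfolding vr prod.case by (rule step_balance[OF \<Phi> w v \<sigma>])
      show "length (snd (step E \<Phi> w x)) \<le> 1"
        unfolding vr using \<Phi> w v by (cases rule: step_cases[where r = r]) simp_all
    qed
  qed
qed


section \<open>Rates in the extended bipartite model\<close>

lemma bip_step_cases:
  assumes E: "sym E" and \<Phi>: "bip_admissible V1 V2 E \<Phi>"
    and xy: "(x, y) \<in> bip_words V1 V2 E" and ij: "i \<in> V1" "j \<in> V2"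
  obtains
    (store) "\<And>a. a \<in> set x \<Longrightarrow> (a, j) \<notin> E" "\<And>b. b \<in> set y \<Longrightarrow> (i, b) \<notin> E" "(i, j) \<notin> E"
      "bip_step E \<Phi> (x, y) ((i, j), (r, s)) = ((x @ [i], y @ [j]), [])"
  | (together) "(i, j) \<in> E" "bip_step E \<Phi> (x, y) ((i, j), (r, s)) = ((x, y), [(i, j)])"
  | (j_matched) k where "\<And>b. b \<in> set y \<Longrightarrow> (i, b) \<notin> E" "k < length x" "(x ! k, j) \<in> E"
      "bip_step E \<Phi> (x, y) ((i, j), (r, s)) = ((remove_nth k x @ [i], y), [(x ! k, j)])"
  | (i_matched) l where "\<And>a. a \<in> set x \<Longrightarrow> (a, j) \<notin> E" "l < length y" "(i, y ! l) \<in> E"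
      "bip_step E \<Phi> (x, y) ((i, j), (r, s)) = ((x, remove_nth l y @ [j]), [(i, y ! l)])"
  | (both_matched) k l where "k < length x" "(x ! k, j) \<in> E" "l < length y" "(i, y ! l) \<in> E"
      "bip_step E \<Phi> (x, y) ((i, j), (r, s))
        = ((remove_nth k x, remove_nth l y), [(x ! k, j), (i, y ! l)])"
proof -
  let ?jm = "compatible_positions E x j \<noteq> {}" and ?im = "compatible_positions E y i \<noteq> {}"
  define k where "k = \<Phi> (x, y) j r"
  define x' where "x' = (if ?jm then remove_nth k x else x)"
  define l where "l = \<Phi> (x', y) i s"
  have xy_lists: "x \<in> lists V1" "y \<in> lists V2" using xy by (auto simp: bip_words_def)
  then have "x' \<in> lists V1" using set_remove_nth[of k x] by (auto simp: x'_def)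
  have k: "k < length x" "(x ! k, j) \<in> E" if ?jm
    using \<Phi> xy_lists ij that by (auto simp: bip_admissible_def k_def compatible_positions_def)
  have "l \<in> compatible_positions E y i" if ?im
    using \<Phi> \<open>x' \<in> lists V1\<close> xy_lists(2) ij that by (auto simp: bip_admissible_def l_def)
  then have l: "l < length y" "(i, y ! l) \<in> E" if ?im
    using that E by (auto simp: compatible_positions_def dest: symD)
  have nj: "(a, j) \<notin> E" if "\<not> ?jm" "a \<in> set x" for a
    using that by (auto simp: compatible_positions_def in_set_conv_nth)
  have ni: "(i, b) \<notin> E" if "\<not> ?im" "b \<in> set y" for b
    using that E by (auto simp: compatible_positions_def in_set_conv_nth dest: symD)
  have eq: "bip_step E \<Phi> (x, y) ((i, j), (r, s)) =
     (if \<not> ?jm \<and> \<not> ?im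
      then (if (i, j) \<in> E then ((x, y), [(i, j)]) else ((x @ [i], y @ [j]), []))
      else ((if ?im then x' else x' @ [i],
             if ?jm then (if ?im then remove_nth l y else y)
             else (if ?im then remove_nth l y else y) @ [j]),
            (if ?jm then [(x ! k, j)] else []) @ (if ?im then [(i, y ! l)] else [])))"
    by (simp add: Let_def k_def x'_def l_def)
  show thesis
  proof (cases ?jm; cases ?im)
    assume "?jm" "?im"
    then show thesis using both_matched[of k l] k l by (simp only: eq) (simp add: x'_def)
  next
    assume "?jm" "\<not> ?im"
    then show thesis using j_matched[of k] k ni by (simp only: eq) (simp add: x'_def)
  next
    assume "\<not> ?jm" "?im"
    then show thesis using i_matched[of l] l nj by (simp only: eq) (simp add: x'_def)
  next
    assume "\<not> ?jm" "\<not> ?im"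
    then show thesis using store together ni nj
      by (cases "(i, j) \<in> E") (simp_all only: eq, simp_all)
  qed
qed

lemma bip_step_in_bip_words:
  assumes "sym E" "bip_admissible V1 V2 E \<Phi>" and xy: "(x, y) \<in> bip_words V1 V2 E"
    and ij: "i \<in> V1" "j \<in> V2"
  shows "fst (bip_step E \<Phi> (x, y) ((i, j), (r, s))) \<in> bip_words V1 V2 E"
proof -
  have w: "set x \<subseteq> V1" "set y \<subseteq> V2" "length x = length y"
    "\<And>a b. a \<in> set x \<Longrightarrow> b \<in> set y \<Longrightarrow> (a, b) \<notin> E"
    using xy by (auto simp: bip_words_def)
  from assms show ?thesis
  proof (cases rule: bip_step_cases[where r = r and s = s])
    case store
    then show ?thesis using w ij by (auto simp: bip_words_def)
  next
    case together
    then show ?thesis using xy by simp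
  next
    case (j_matched k)
    then show ?thesis using w ij set_remove_nth[of k x] length_remove_nth[of k x]
      by (auto simp: bip_words_def subset_iff)
  next
    case (i_matched l)
    then show ?thesis using w ij set_remove_nth[of l y] length_remove_nth[of l y]
      by (auto simp: bip_words_def subset_iff)
  next
    case (both_matched k l)
    then show ?thesis
      using w set_remove_nth[of k x] length_remove_nth[of k x]
        set_remove_nth[of l y] length_remove_nth[of l y]
      by (auto simp: bip_words_def subset_iff)
  qed
qed

lemma bip_step_balance:
  fixes \<sigma> :: "'a \<Rightarrow> real"
  assumes "sym E" "bip_admissible V1 V2 E \<Phi>" "(x, y) \<in> bip_words V1 V2 E" "i \<in> V1" "j \<in> V2"
    and \<sigma>: "isolates E \<sigma> a b"
  defines "W \<equiv> \<lambda>(x, y). sum_list (map \<sigma> x) + sum_list (map \<sigma> y)"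
  shows "W (fst (bip_step E \<Phi> (x, y) ((i, j), (r, s))))
      + real (length (filter (\<lambda>p. p = (a, b) \<or> p = (b, a))
          (snd (bip_step E \<Phi> (x, y) ((i, j), (r, s))))))
    = W (x, y) + (\<sigma> i + \<sigma> j)"
  using assms(1-5)
proof (cases rule: bip_step_cases[where r = r and s = s])
  case store
  then show ?thesis by (simp add: W_def)
next
  case together
  show ?thesis
    unfolding together(2) fst_conv snd_conv length_filter_isolated[OF \<sigma> together(1)] by simp
next
  case (j_matched k)
  show ?thesis
    unfolding j_matched(4) fst_conv snd_conv length_filter_isolated[OF \<sigma> j_matched(3)]
    by (simp add: W_def sum_list_remove_nth[OF j_matched(2)])
next
  case (i_matched l)
  show ?thesis
    unfolding i_matched(4) fst_conv snd_conv length_filter_isolated[OF \<sigma> i_matched(3)]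
    by (simp add: W_def sum_list_remove_nth[OF i_matched(2)])
next
  case (both_matched k l)
  have "length (filter P [p, q]) = length (filter P [p]) + length (filter P [q])"
    for P and p q :: "'a \<times> 'a"
    by simp
  then show ?thesis
    unfolding both_matched(5) fst_conv snd_conv
    by (simp only: of_nat_add length_filter_isolated[OF \<sigma> both_matched(2)]
        length_filter_isolated[OF \<sigma> both_matched(4)])
       (simp add: W_def sum_list_remove_nth[OF both_matched(1)] sum_list_remove_nth[OF both_matched(3)])
qed

text \<open>
  The next state depends on the two draws only through the two chosen positions. The second choice
  depends on the first, which takes countably many values and may thus be held fixed.
\<close>

lemma measurable_bip_step:
  assumes \<Phi>: "bip_admissible V1 V2 E \<Phi>" and xy: "(x, y) \<in> bip_words V1 V2 E"
    and ij: "i \<in> V1" "j \<in> V2"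
  shows "(\<lambda>u. fst (bip_step E \<Phi> (x, y) ((i, j), u)))
    \<in> uniform_draw \<Otimes>\<^sub>M uniform_draw \<rightarrow>\<^sub>M count_space UNIV"
proof -
  let ?jm = "compatible_positions E x j \<noteq> {}" and ?im = "compatible_positions E y i \<noteq> {}"
  define X where "X k = (if ?jm then remove_nth k x else x)" for k
  define Y where "Y l = (if ?im then remove_nth l y else y)" for l
  define H where "H k l = (if \<not> ?jm \<and> \<not> ?im then (if (i, j) \<in> E then (x, y) else (x @ [i], y @ [j]))
      else (if ?im then X k else X k @ [i], if ?jm then Y l else Y l @ [j]))" for k l
  have H: "fst (bip_step E \<Phi> (x, y) ((i, j), u))
      = H (\<Phi> (x, y) j (fst u)) (\<Phi> (X (\<Phi> (x, y) j (fst u)), y) i (snd u))" for u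
    by (cases u) (simp add: H_def X_def Y_def Let_def)
  have "x \<in> lists V1" "y \<in> lists V2" using xy by (auto simp: bip_words_def)
  moreover have "X k \<in> lists V1" for k
    using \<open>x \<in> lists V1\<close> set_remove_nth[of k x] by (auto simp: X_def)
  ultimately have [measurable]: "\<Phi> (x, y) j \<in> borel \<rightarrow>\<^sub>M count_space UNIV"
    "\<Phi> (X k, y) i \<in> borel \<rightarrow>\<^sub>M count_space UNIV" for k
    using \<Phi> ij by (auto simp: bip_admissible_def)
  have "(\<lambda>u. H k (\<Phi> (X k, y) i (snd u))) \<in> uniform_draw \<Otimes>\<^sub>M uniform_draw \<rightarrow>\<^sub>M count_space UNIV" for k
    by measurable
  then show ?thesis
    unfolding H by (rule measurable_compose_countable) measurable
qed

text \<open>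
  As in the general model, the rate is a mean under the input law; both items of a couple contribute.
\<close>

lemma bip_policy_invariant_if_isolable:
  assumes G: "multigraph V E" and bip: "bipartition V E V1 V2" and iso: "edges_isolable E"
  shows "bip_policy_invariant V1 V2 E"
  unfolding bip_policy_invariant_def
proof (intro ballI)
  fix \<mu> \<nu> assume "\<nu> \<in> couplings V1 V2 \<mu>"
  have symE: "sym E" using G by (simp add: multigraph_def)
  have fin: "finite V1" "finite V2"
    using G bip by (auto simp: multigraph_def bipartition_def)
  obtain pot where pot: "\<And>i j. (i, j) \<in> E \<Longrightarrow> isolates E (pot i j) i j"
    using iso unfolding edges_isolable_def by metis
  define \<theta> where "\<theta> a b = (\<integral>((i, j), u). pot a b i + pot a b j \<partial>bip_input_law V1 V2 \<nu>)" for a b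
  show "\<exists>\<theta>. \<forall>\<Phi>. bip_admissible V1 V2 E \<Phi> \<longrightarrow> \<nu> \<in> bip_stab V1 V2 E \<Phi> \<longrightarrow>
      (\<forall>(i, j) \<in> E. bip_asymptotic_matching_rate V1 V2 E \<Phi> \<nu> i j (\<theta> i j))"
  proof (intro exI[of _ \<theta>] allI impI ballI, clarify)
    fix \<Phi> a b
    assume \<Phi>: "bip_admissible V1 V2 E \<Phi>" and stab: "\<nu> \<in> bip_stab V1 V2 E \<Phi>" and "(a, b) \<in> E"
    note \<sigma> = pot[OF \<open>(a, b) \<in> E\<close>]
    have \<nu>: "\<nu> \<in> full_prob_measures (V1 \<times> V2)"
      and rec: "positive_recurrent (bip_input_law V1 V2 \<nu>) (bip_step E \<Phi>) (bip_words V1 V2 E)"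
      using stab by (auto simp: bip_stab_def)
    note law = finite_product_law[OF finite_cartesian_product[OF fin] \<nu>
        prob_space_pair[OF prob_space_uniform_draw prob_space_uniform_draw], folded bip_input_law_def]
    have space: "space (bip_input_law V1 V2 \<nu>) = (V1 \<times> V2) \<times> UNIV"
      by (simp add: law(2) space_pair_measure space_uniform_draw)
    interpret prob_space "bip_input_law V1 V2 \<nu>" by (rule law(1))
    interpret random_recursion "bip_input_law V1 V2 \<nu>" "bip_step E \<Phi>" "bip_words V1 V2 E"
    proof
      have "countable (lists V1 \<times> lists V2)"
        using fin by (intro countable_SIGMA countable_lists) (auto intro: countable_finite)
      then show "countable (bip_words V1 V2 E)"
        by (rule countable_subset[rotated]) (auto simp: bip_words_def)
      fix t assume t: "t \<in> bip_words V1 V2 E"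
      obtain x y where xy: "t = (x, y)" by (cases t)
      note t = t[unfolded xy]
      show "(\<lambda>u. fst (bip_step E \<Phi> t u)) \<in> bip_input_law V1 V2 \<nu> \<rightarrow>\<^sub>M count_space (bip_words V1 V2 E)"
        unfolding xy
      proof (rule measurable_restrict_count_space)
        show "(\<lambda>u. fst (bip_step E \<Phi> (x, y) u)) \<in> bip_input_law V1 V2 \<nu> \<rightarrow>\<^sub>M count_space UNIV"
        proof (rule law(3))
          fix p assume "p \<in> V1 \<times> V2"
          then obtain i j where "p = (i, j)" "i \<in> V1" "j \<in> V2" by blast
          then show "(\<lambda>u. fst (bip_step E \<Phi> (x, y) (p, u)))
              \<in> uniform_draw \<Otimes>\<^sub>M uniform_draw \<rightarrow>\<^sub>M count_space UNIV"
            using measurable_bip_step[OF \<Phi> t] by simp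
        qed
        show "(\<lambda>u. fst (bip_step E \<Phi> (x, y) u)) \<in> space (bip_input_law V1 V2 \<nu>) \<rightarrow> bip_words V1 V2 E"
          using bip_step_in_bip_words[OF symE \<Phi> t]
          by (auto simp only: space Pi_iff mem_Times_iff split_paired_all fst_conv snd_conv)
      qed
    qed
    let ?W = "\<lambda>(x, y). sum_list (map (pot a b) x) + sum_list (map (pot a b) y)"
    show "bip_asymptotic_matching_rate V1 V2 E \<Phi> \<nu> a b (\<theta> a b)"
      unfolding bip_asymptotic_matching_rate_def \<theta>_def
    proof (rule matching_rate_of_balance[OF rec, where g = ?W
          and B = "(\<Sum>u\<in>V1. \<bar>pot a b u\<bar>) + (\<Sum>u\<in>V2. \<bar>pot a b u\<bar>)" and N = 2])
      show "(\<lambda>((i, j), u). pot a b i + pot a b j) \<in> borel_measurable (bip_input_law V1 V2 \<nu>)"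
        by (rule law(3)) (simp add: split_beta)
      fix z :: "('a \<times> 'a) \<times> real \<times> real" assume z: "z \<in> space (bip_input_law V1 V2 \<nu>)"
      obtain i j r s where z_eq: "z = ((i, j), (r, s))" by (metis surj_pair)
      with z have ij: "i \<in> V1" "j \<in> V2" by (auto simp: space)
      show "\<bar>(\<lambda>((i, j), u). pot a b i + pot a b j) z\<bar>
          \<le> (\<Sum>u\<in>V1. \<bar>pot a b u\<bar>) + (\<Sum>u\<in>V2. \<bar>pot a b u\<bar>)"
        using abs_le_sum_abs[OF fin(1) ij(1), of "pot a b"] abs_le_sum_abs[OF fin(2) ij(2), of "pot a b"]
        unfolding z_eq prod.case by linarith
      fix t assume "t \<in> bip_words V1 V2 E"
      moreover obtain x y where xy: "t = (x, y)" by (cases t)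
      ultimately have t: "(x, y) \<in> bip_words V1 V2 E" by simp
      show "?W (fst (bip_step E \<Phi> t z))
          + real (length (filter (\<lambda>p. p = (a, b) \<or> p = (b, a)) (snd (bip_step E \<Phi> t z))))
          = ?W t + (\<lambda>((i, j), u). pot a b i + pot a b j) z"
        using bip_step_balance[OF symE \<Phi> t ij \<sigma>, of r s] unfolding z_eq xy prod.case .
      show "length (snd (bip_step E \<Phi> t z)) \<le> 2"
        unfolding z_eq xy using symE \<Phi> t ij
        by (cases rule: bip_step_cases[where r = r and s = s]) simp_all
    qed
  qed
qed


section \<open>Policy-invariance\<close>

theorem theorem4:
  fixes V :: "'a set" and E :: "('a \<times> 'a) set"
  assumes "multigraph V E" and "connected_graph V E" and "2 \<le> card V"
    and "odd_cycle_graph V E \<or> tree_graph V E \<or> tree_plus_odd_edge V E \<or> tree_plus_self_loop V E"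
  shows "policy_invariant V E"
proof -
  have "edges_isolable E" using assms(4) by (rule unicyclic_or_tree_isolable)
  then show ?thesis
    unfolding policy_invariant_def
    using gen_policy_invariant_if_isolable[OF assms(1)] bip_policy_invariant_if_isolable[OF assms(1)]
    by simp
qed

end
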